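(* Fix a constant $c>1$ and let $m=m(n)$ satisfy $n+2\le m\le cn$. Then for every even positive integer $n$ there exists a family $\mathcal{H}(n,m)$ of strictly balanced and asymmetric graphs on vertex set $[n]$ with $m$ edges such that $|\mathcal{H}(n,m)|=\exp(-O(n))\,n^{m}$.
   Context: For a graph $H$, $d(H)=e(H)/v(H)$ is its density. $H$ is strictly balanced if $d(H)>d(H_0)$ for every proper subgraph $H_0\subsetneq H$. $H$ is asymmetric if its automorphism group is trivial. Graphs are labelled, with vertex set $[n]=\{1,\dots,n\}$. The notation $\exp(-O(n))n^m$ means a quantity lying between $e^{-Cn}n^m$ and $e^{Cn}n^m$ for a constant $C$ (depending on $c$) independent of $n$.
   Formalization: The lower bound e^{-Cn}n^m on |H(n,m)| is asserted only for n ≥ N with N depending only on c; for all even n it fails, e.g. c=2, n=2, m=4, where no simple graph with 4 edges exists. *)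

theory Defs
  imports Complex_Main "HOL-Combinatorics.Permutations"
begin

type_synonym 'a graph = "'a set \<times> 'a set set"

abbreviation verts :: "'a graph \<Rightarrow> 'a set" where
  "verts G \<equiv> fst G"

abbreviation edges :: "'a graph \<Rightarrow> 'a set set" where
  "edges G \<equiv> snd G"

definition simple_graph :: "'a graph \<Rightarrow> bool" where
  "simple_graph G \<longleftrightarrow> finite (verts G) \<and> (\<forall>e \<in> edges G. e \<subseteq> verts G \<and> card e = 2)"

definition density :: "'a graph \<Rightarrow> real" where
  "density G = real (card (edges G)) / real (card (verts G))"

definition proper_subgraph :: "'a graph \<Rightarrow> 'a graph \<Rightarrow> bool" where
  "proper_subgraph H G \<longleftrightarrow>
     simple_graph H \<and> verts H \<subseteq> verts G \<and> edges H \<subseteq> edges G \<and> H \<noteq> G"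

text \<open>The null subgraph is excluded because it has no density.\<close>

definition strictly_balanced :: "'a graph \<Rightarrow> bool" where
  "strictly_balanced G \<longleftrightarrow>
     (\<forall>H. proper_subgraph H G \<and> verts H \<noteq> {} \<longrightarrow> density H < density G)"

text \<open>Automorphisms are represented as permutations fixing everything outside the vertex set,
  so that each automorphism corresponds to exactly one function.\<close>

definition automorphisms :: "'a graph \<Rightarrow> ('a \<Rightarrow> 'a) set" where
  "automorphisms G = {f. f permutes verts G \<and>
     (\<forall>u \<in> verts G. \<forall>v \<in> verts G. {f u, f v} \<in> edges G \<longleftrightarrow> {u, v} \<in> edges G)}"

definition asymmetric :: "'a graph \<Rightarrow> bool" where
  "asymmetric G \<longleftrightarrow> automorphisms G = {id}"

end

theory Submission
  imports Defs
begin

text \<open>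
  Write \<open>m = n + k\<close> and split a Hamiltonian cycle on the positions \<open>0, \<dots>, n - 1\<close> into a long arc of
  \<open>a\<close> vertices and a short arc of \<open>b = n div 16\<close> vertices. Add \<open>k\<close> chords between the arcs whose ends
  are spread evenly along each arc (in groups of two or three on the short one).

  Strict balance: let every chord give the fraction \<open>a / n\<close> of its weight to its end in the long arc
  and \<open>b / n\<close> to the other end. As the ends are evenly spread, the cycle edges can divide their
  weights such that each vertex receives exactly \<open>m / n\<close>, and some edge leaving a proper vertex set
  \<open>S\<close> always gives something to \<open>S\<close>.

  Asymmetry: chord ends in the short arc have larger degree than chord ends in the long arc. Hence an
  automorphism recognises the arcs (if \<open>k \<ge> a\<close>) or the chords (if \<open>k < a\<close>), so it acts on paths
  or on a cycle; the few remaining reversals and rotations are excluded by one forced and two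
  forbidden chords, respectively by the positions of the chord ends.

  Counting: the pairing of the chord ends is free up to a bounded number of colours, which leaves
  \<open>exp (- O(n)) * k!\<close> pairings, and there are \<open>n!\<close> labellings. Since degrees are bounded, a
  labelled graph arises from at most \<open>exp (O(n))\<close> pairs, because a Hamiltonian cycle can be traced
  step by step. Finally \<open>n! * k! \<ge> exp (- 2 * n) * n ^ (n + k)\<close>.
\<close>

section \<open>Counting permutations and pairings\<close>

lemma card_le_card_mult_fibres:
  assumes "finite A" "finite B" "f ` A \<subseteq> B" "\<And>y. y \<in> B \<Longrightarrow> card {x \<in> A. f x = y} \<le> M"
  shows "card A \<le> card B * M"
proof -
  have "A = (\<Union>y\<in>B. {x \<in> A. f x = y})" using assms(3) by auto
  then have "card A \<le> (\<Sum>y\<in>B. card {x \<in> A. f x = y})"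
    using card_UN_le[OF assms(2), of "\<lambda>y. {x \<in> A. f x = y}"] by simp
  also have "\<dots> \<le> card B * M" using sum_bounded_above[of B _ M] assms(4) by simp
  finally show ?thesis .
qed

text \<open>Elements are coloured one at a time: a new element conflicts with at most
  \<open>d\<close> earlier ones, so one of the \<open>d + 1\<close> colours is free.\<close>

lemma greedy_colouring:
  assumes "finite X" "\<And>x. x \<in> X \<Longrightarrow> card {y \<in> X. R x y \<and> y \<noteq> x} \<le> d" "\<And>x y. R x y \<Longrightarrow> R y x"
  shows "\<exists>col :: 'a \<Rightarrow> nat. (\<forall>x\<in>X. col x \<le> d) \<and> (\<forall>x\<in>X. \<forall>y\<in>X. x \<noteq> y \<and> R x y \<longrightarrow> col x \<noteq> col y)"
  using assms(1,2)
proof (induction X rule: finite_induct)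
  case empty
  then show ?case by simp
next
  case (insert x F)
  have "card {z \<in> F. R y z \<and> z \<noteq> y} \<le> d" if "y \<in> F" for y
  proof -
    have "card {z \<in> F. R y z \<and> z \<noteq> y} \<le> card {z \<in> insert x F. R y z \<and> z \<noteq> y}"
      using insert.hyps by (intro card_mono) auto
    with insert.prems[of y] that show ?thesis by simp
  qed
  then obtain col :: "'a \<Rightarrow> nat" where col: "\<forall>x\<in>F. col x \<le> d"
      "\<forall>x\<in>F. \<forall>y\<in>F. x \<noteq> y \<and> R x y \<longrightarrow> col x \<noteq> col y"
    using insert.IH by blast
  let ?N = "{y \<in> F. R x y}"
  have "?N = {y \<in> insert x F. R x y \<and> y \<noteq> x}" using insert.hyps by auto
  then have "card ?N \<le> d" using insert.prems[of x] by simp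
  then have "card (col ` ?N) \<le> d" using card_image_le[of ?N col] insert.hyps by fastforce
  then have "card (col ` ?N) < card {..d}" by simp
  moreover have "finite (col ` ?N)" using insert.hyps by simp
  ultimately have "\<not> {..d} \<subseteq> col ` ?N" by (metis card_mono leD)
  then obtain z where z: "z \<le> d" "z \<notin> col ` ?N" by auto
  have "(\<forall>y\<in>insert x F. (col(x := z)) y \<le> d) \<and>
      (\<forall>y\<in>insert x F. \<forall>y'\<in>insert x F. y \<noteq> y' \<and> R y y' \<longrightarrow> (col(x := z)) y \<noteq> (col(x := z)) y')"
    using col z assms(3) by auto
  then show ?case by blast
qed

text \<open>Sort all permutations by their colour pattern \<open>col \<circ> p\<close>. There are at
  most \<open>K ^ card T\<close> patterns, and within one pattern composition with the inverse of a
  fixed member \<open>p0\<close> maps injectively into the colour-preserving permutations.\<close>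

lemma fact_le_card_colour_preserving_permutations:
  assumes "finite T" "\<And>t. t \<in> T \<Longrightarrow> col t < K"
  shows "fact (card T) \<le> K ^ card T * card {p. p permutes T \<and> (\<forall>t\<in>T. col (p t) = col t)}"
proof -
  let ?A = "{p. p permutes T}" and ?B = "PiE T (\<lambda>_. {..<K})"
  let ?G = "{p. p permutes T \<and> (\<forall>t\<in>T. col (p t) = col t)}"
  have "card ?A \<le> card ?B * card ?G"
  proof (rule card_le_card_mult_fibres)
    show "finite ?A" by (rule finite_permutations[OF assms(1)])
    show "finite ?B" by (intro finite_PiE assms) auto
    show "(\<lambda>p. restrict (col \<circ> p) T) ` ?A \<subseteq> ?B"
      using assms(2) by (auto simp: permutes_in_image)
  next
    fix c assume "c \<in> ?B"
    let ?F = "{p \<in> ?A. restrict (col \<circ> p) T = c}"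
    show "card ?F \<le> card ?G"
    proof (cases "?F = {}")
      case True
      then show ?thesis by (simp only: card.empty)
    next
      case False
      then obtain p0 where p0: "p0 permutes T" "restrict (col \<circ> p0) T = c" by auto
      show ?thesis
      proof (rule card_inj_on_le[of "\<lambda>p. p \<circ> inv p0"])
        show "finite ?G" by (rule finite_subset[OF _ finite_permutations[OF assms(1)]]) auto
        show "inj_on (\<lambda>p. p \<circ> inv p0) ?F"
        proof (rule inj_onI)
          fix p p' assume "p \<circ> inv p0 = p' \<circ> inv p0"
          then have "p \<circ> inv p0 \<circ> p0 = p' \<circ> inv p0 \<circ> p0" by simp
          then show "p = p'" by (simp add: comp_assoc permutes_inv_o[OF p0(1)])
        qed
        show "(\<lambda>p. p \<circ> inv p0) ` ?F \<subseteq> ?G"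
        proof safe
          fix p assume p: "p permutes T" "c = restrict (col \<circ> p) T"
          show "p \<circ> inv p0 permutes T" by (intro permutes_compose permutes_inv p p0)
          fix t assume t: "t \<in> T"
          have "inv p0 t \<in> T" using t permutes_in_image[OF permutes_inv[OF p0(1)]] by simp
          then have "col (p (inv p0 t)) = col (p0 (inv p0 t))"
            using p p0 by (metis comp_apply restrict_apply')
          then show "col ((p \<circ> inv p0) t) = col t" by (simp add: permutes_inverses[OF p0(1)])
        qed
      qed
    qed
  qed
  then show ?thesis using assms(1) by (simp add: card_permutations card_PiE)
qed

text \<open>\<open>P\<close> holds the pairs in use and the pairs to be avoided. First components
  with a common partner in \<open>P\<close> get different colours, which takes
  \<open>d * d + 1\<close> colours. A permutation that preserves the colours can then create neither
  a repeated nor an avoided pair.\<close>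

lemma many_simple_pairings:
  fixes k :: nat and f :: "nat \<Rightarrow> 'a" and g :: "nat \<Rightarrow> 'b" and \<Phi> :: "('a \<times> 'b) set"
  defines "P \<equiv> (\<lambda>t. (f t, g t)) ` {..<k} \<union> \<Phi>"
  assumes inj: "inj_on (\<lambda>t. (f t, g t)) {..<k}" and avoid: "\<And>t. t < k \<Longrightarrow> (f t, g t) \<notin> \<Phi>"
    and fin: "finite \<Phi>" and u: "u < k"
    and rows: "\<And>x. card {y. (x, y) \<in> P} \<le> d" and cols: "\<And>y. card {x. (x, y) \<in> P} \<le> d"
  shows "fact k \<le> (d * d + 2) ^ k * card {p. p permutes {..<k} \<and> p u = u \<and>
           inj_on (\<lambda>t. (f (p t), g t)) {..<k} \<and> (\<forall>t<k. (f (p t), g t) \<notin> \<Phi>)}"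
proof -
  have finP: "finite P" using fin by (simp add: P_def)
  have fr: "finite {y. (x, y) \<in> P}" for x
    by (rule finite_subset[OF _ finite_imageI[OF finP, of snd]]) force
  have fc: "finite {x. (x, y) \<in> P}" for y
    by (rule finite_subset[OF _ finite_imageI[OF finP, of fst]]) force
  define R where "R x x' \<longleftrightarrow> (\<exists>y. (x, y) \<in> P \<and> (x', y) \<in> P)" for x x'
  have "\<exists>col. (\<forall>x\<in>fst ` P. col x \<le> d * d) \<and>
      (\<forall>x\<in>fst ` P. \<forall>y\<in>fst ` P. x \<noteq> y \<and> R x y \<longrightarrow> col x \<noteq> (col y :: nat))"
  proof (rule greedy_colouring)
    fix x assume "x \<in> fst ` P"
    have "card {y \<in> fst ` P. R x y \<and> y \<noteq> x} \<le> card (\<Union>y\<in>{y. (x, y) \<in> P}. {x'. (x', y) \<in> P})"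
      using fr fc by (intro card_mono) (auto simp: R_def)
    also have "\<dots> \<le> (\<Sum>y\<in>{y. (x, y) \<in> P}. card {x'. (x', y) \<in> P})" by (rule card_UN_le[OF fr])
    also have "\<dots> \<le> card {y. (x, y) \<in> P} * d"
      using sum_bounded_above[of "{y. (x, y) \<in> P}" _ d] cols by simp
    also have "\<dots> \<le> d * d" using rows by simp
    finally show "card {y \<in> fst ` P. R x y \<and> y \<noteq> x} \<le> d * d" .
  qed (use finP in \<open>auto simp: R_def\<close>)
  then obtain col :: "'a \<Rightarrow> nat" where col': "\<forall>x\<in>fst ` P. col x \<le> d * d"
    "\<forall>x\<in>fst ` P. \<forall>y\<in>fst ` P. x \<noteq> y \<and> R x y \<longrightarrow> col x \<noteq> col y" by (elim exE conjE)
  have col: "x \<in> fst ` P \<Longrightarrow> col x \<le> d * d"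
    "x \<in> fst ` P \<Longrightarrow> y \<in> fst ` P \<Longrightarrow> R x y \<Longrightarrow> col x = col y \<Longrightarrow> x = y" for x y
    using col' by metis+
  \<comment> \<open>A colour reserved for \<open>u\<close> forces \<open>p u = u\<close>; it brings
    the number of colours to \<open>d * d + 2\<close>.\<close>
  define C where "C t = (if t = u then d * d + 1 else col (f t))" for t
  have inP: "t < k \<Longrightarrow> (f t, g t) \<in> P" for t by (auto simp: P_def)
  have fP: "t < k \<Longrightarrow> f t \<in> fst ` P" for t using inP by force
  let ?G = "{p. p permutes {..<k} \<and> p u = u \<and> inj_on (\<lambda>t. (f (p t), g t)) {..<k} \<and>
    (\<forall>t<k. (f (p t), g t) \<notin> \<Phi>)}"
  have finG: "finite ?G" by (rule finite_subset[OF _ finite_permutations[of "{..<k}"]]) auto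
  have "fact (card {..<k}) \<le> (d * d + 2) ^ card {..<k} *
      card {p. p permutes {..<k} \<and> (\<forall>t\<in>{..<k}. C (p t) = C t)}"
  proof (rule fact_le_card_colour_preserving_permutations)
    fix t assume "t \<in> {..<k}"
    then show "C t < d * d + 2" using col(1)[OF fP, of t] by (auto simp: C_def)
  qed simp
  also have "card {p. p permutes {..<k} \<and> (\<forall>t\<in>{..<k}. C (p t) = C t)} \<le> card ?G"
  proof (rule card_mono[OF finG], safe)
    fix p assume p: "p permutes {..<k}" "\<forall>t\<in>{..<k}. C (p t) = C t"
    have pk: "p t < k" if "t < k" for t using permutes_in_image[OF p(1)] that by simp
    show pu: "p u = u"
      using p(2)[rule_format, of u] u col(1)[OF fP[OF pk[OF u]]] by (auto simp: C_def split: if_splits)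
    have same: "col (f (p t)) = col (f t)" if "t < k" for t
    proof (cases "t = u")
      case False
      then have "p t \<noteq> u" using pu permutes_inj[OF p(1)] by (metis injD)
      then show ?thesis using False p(2)[rule_format, of t] that by (simp add: C_def)
    qed (simp add: pu)
    show "inj_on (\<lambda>t. (f (p t), g t)) {..<k}"
    proof (rule inj_onI)
      fix t t' assume t: "t \<in> {..<k}" "t' \<in> {..<k}" "(f (p t), g t) = (f (p t'), g t')"
      then have "col (f t) = col (f t')" using same by (metis Pair_inject lessThan_iff)
      moreover have "R (f t) (f t')" unfolding R_def using t inP[of t] inP[of t'] by (intro exI[of _ "g t"]) simp
      ultimately have "f t = f t'" using col(2) fP t by auto
      then show "t = t'" using inj t by (auto simp: inj_on_def)
    qed
    fix t assume t: "t < k" "(f (p t), g t) \<in> \<Phi>"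
    \<comment> \<open>\<open>f t\<close> and \<open>f (p t)\<close> share the partner
      \<open>g t\<close> in \<open>P\<close> and have the same colour, so they coincide. The
      original pairing would then already contain an avoided pair.\<close>
    then have "(f (p t), g t) \<in> P" by (simp add: P_def)
    then have "f t = f (p t)" using col(2)[OF fP[OF t(1)] fP[OF pk[OF t(1)]]] same[OF t(1)] inP[OF t(1)]
      by (auto simp: R_def)
    then show False using t avoid[of t] by simp
  qed
  finally show ?thesis by simp
qed

section \<open>Strict balance from weight sharing\<close>

lemma finite_edges: "simple_graph G \<Longrightarrow> finite (edges G)"
  by (rule finite_subset[of _ "Pow (verts G)"]) (auto simp: simple_graph_def)

text \<open>A proper subgraph on all vertices lacks an edge, and any other one has at most the edges
  induced by its vertex set. So only induced edge counts matter, and the density inequality is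
  cross-multiplied to stay within the natural numbers.\<close>

lemma strictly_balancedI:
  assumes G: "simple_graph G"
    and sparse: "\<And>S. S \<subseteq> verts G \<Longrightarrow> S \<noteq> {} \<Longrightarrow> S \<noteq> verts G \<Longrightarrow>
      card (verts G) * card {e \<in> edges G. e \<subseteq> S} < card (edges G) * card S"
  shows "strictly_balanced G"
  unfolding strictly_balanced_def
proof (intro allI impI, elim conjE)
  fix H assume H: "proper_subgraph H G" "verts H \<noteq> {}"
  have fin: "finite (verts G)" using G by (simp add: simple_graph_def)
  have finE: "finite (edges G)" by (rule finite_edges[OF G])
  have sub: "verts H \<subseteq> verts G" "edges H \<subseteq> edges G" "H \<noteq> G" "simple_graph H"
    using H by (auto simp: proper_subgraph_def)
  have finH: "finite (verts H)" using sub fin finite_subset by blast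
  have pos: "card (verts H) > 0" "card (verts G) > 0" using finH H sub fin by (auto simp: card_gt_0_iff)
  show "density H < density G"
  proof (cases "verts H = verts G")
    case True
    then have "edges H \<subset> edges G" using sub by (auto simp: prod_eq_iff)
    then have "card (edges H) < card (edges G)" using finE by (rule psubset_card_mono[rotated])
    then show ?thesis using True pos by (simp add: density_def divide_strict_right_mono)
  next
    case False
    have "edges H \<subseteq> {e \<in> edges G. e \<subseteq> verts H}" using sub by (auto simp: simple_graph_def)
    then have "card (edges H) \<le> card {e \<in> edges G. e \<subseteq> verts H}" using finE by (intro card_mono) auto
    then have "card (verts G) * card (edges H) < card (edges G) * card (verts H)"
      using sparse[OF sub(1) H(2) False] by (meson le_less_trans mult_le_mono2)
    then have "real (card (verts G)) * real (card (edges H)) < real (card (edges G)) * real (card (verts H))"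
      by (metis of_nat_less_iff of_nat_mult)
    then show ?thesis using pos by (simp add: density_def field_simps)
  qed
qed

lemma sum_Suc_mod:
  fixes F :: "nat \<Rightarrow> 'a :: comm_monoid_add"
  shows "(\<Sum>i<n. F (Suc i mod n)) = (\<Sum>i<n. F i)"
proof (cases n)
  case (Suc l)
  have "(\<Sum>i<Suc l. F (Suc i mod Suc l)) = (\<Sum>i<l. F (Suc i mod Suc l)) + F 0" by simp
  also have "(\<Sum>i<l. F (Suc i mod Suc l)) = (\<Sum>i<l. F (Suc i))" by (intro sum.cong) auto
  also have "(\<Sum>i<l. F (Suc i)) + F 0 = (\<Sum>i<Suc l. F i)" by (simp add: sum.lessThan_Suc_shift add.commute del: sum.lessThan_Suc)
  finally show ?thesis using Suc by simp
qed simp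

text \<open>A nonempty set closed under the cyclic successor contains everything, because iteration
  from one element reaches every residue.\<close>

lemma cyclic_boundary:
  assumes "S \<subseteq> {..<n}" "S \<noteq> {}" "S \<noteq> {..<n::nat}"
  shows "\<exists>i\<in>S. Suc i mod n \<notin> S"
proof (rule ccontr)
  assume "\<not> ?thesis"
  then have closed: "Suc i mod n \<in> S" if "i \<in> S" for i using that by blast
  obtain x where x: "x \<in> S" using assms by blast
  then have xn: "x < n" using assms by auto
  have all: "(x + j) mod n \<in> S" for j
  proof (induction j)
    case (Suc j)
    then show ?case using closed[OF Suc] by (simp add: mod_Suc_eq)
  qed (use x xn in simp)
  have "y \<in> S" if "y < n" for y
  proof -
    have "(x + (n - x + y)) mod n = y" using xn that by simp
    then show ?thesis using all by metis
  qed
  then show False using assms by auto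
qed

lemma sum_card_fibres:
  assumes "finite S"
  shows "(\<Sum>i\<in>S. card {t \<in> {..<k}. f t = i}) = card {t \<in> {..<k::nat}. f t \<in> S}"
proof -
  have "card (\<Union>i\<in>S. {t \<in> {..<k}. f t = i}) = (\<Sum>i\<in>S. card {t \<in> {..<k}. f t = i})"
    by (rule card_UN_disjoint) (use assms in auto)
  moreover have "(\<Union>i\<in>S. {t \<in> {..<k}. f t = i}) = {t \<in> {..<k}. f t \<in> S}" by auto
  ultimately show ?thesis by simp
qed

text \<open>Every edge distributes weight \<open>n\<close> over its two ends: the chord \<open>t\<close> gives \<open>\<alpha>\<close> to \<open>f t\<close> and
  \<open>\<beta>\<close> to \<open>g t\<close>, and the cycle edge from \<open>i\<close> to \<open>i + 1\<close> gives \<open>\<phi> (i + 1)\<close> to \<open>i + 1\<close> and the rest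
  to \<open>i\<close>. The potential \<open>\<phi>\<close> is chosen such that every vertex receives exactly \<open>n + k\<close>.\<close>

lemma cycle_with_chords_sparse:
  fixes n k \<alpha> \<beta> :: nat and f g :: "nat \<Rightarrow> nat"
  defines "w \<equiv> \<lambda>i. \<alpha> * card {t \<in> {..<k}. f t = i} + \<beta> * card {t \<in> {..<k}. g t = i}"
  assumes weights: "\<alpha> + \<beta> = n" and ends: "\<And>t. t < k \<Longrightarrow> f t < n \<and> g t < n"
    and low: "\<And>i. i \<le> n \<Longrightarrow> k * i \<le> (\<Sum>j<i. w j)"
    and high: "\<And>i. i \<le> n \<Longrightarrow> (\<Sum>j<i. w j) < k * i + n"
    and S: "S \<subseteq> {..<n}" "S \<noteq> {}" "S \<noteq> {..<n}"
  shows "n * (card {i \<in> {..<n}. i \<in> S \<and> Suc i mod n \<in> S} + card {t \<in> {..<k}. f t \<in> S \<and> g t \<in> S})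
     < (n + k) * card S"
proof -
  \<comment> \<open>The positions below \<open>i\<close> receive \<open>\<phi> i\<close> more chord
    weight than \<open>k\<close> each. The cycle edge between \<open>i - 1\<close> and
    \<open>i\<close> passes this surplus on to \<open>i\<close>; by \<open>low\<close> and
    \<open>high\<close> it is nonnegative and less than \<open>n\<close>, so it is an admissible
    share.\<close>
  define \<phi> where "\<phi> i = int (\<Sum>j<i. w j) - int k * int i" for i
  have finS: "finite S" using S finite_subset by blast
  have \<phi>0: "\<phi> 0 = 0" by (simp add: \<phi>_def)
  have "(\<Sum>j<n. w j) = \<alpha> * (\<Sum>j<n. card {t \<in> {..<k}. f t = j}) + \<beta> * (\<Sum>j<n. card {t \<in> {..<k}. g t = j})"
    by (simp add: w_def sum.distrib sum_distrib_left)
  also have "(\<Sum>j<n. card {t \<in> {..<k}. f t = j}) = k"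
    using sum_card_fibres[of "{..<n}" k f] ends by (simp add: Collect_conj_eq[symmetric] cong: conj_cong)
  also have "(\<Sum>j<n. card {t \<in> {..<k}. g t = j}) = k"
    using sum_card_fibres[of "{..<n}" k g] ends by (simp add: Collect_conj_eq[symmetric] cong: conj_cong)
  finally have "(\<Sum>j<n. w j) = n * k" using weights by (simp add: add_mult_distrib[symmetric])
  then have \<phi>n: "\<phi> n = 0" by (simp add: \<phi>_def)
  have \<phi>mod: "\<phi> (Suc i mod n) = \<phi> (Suc i)" if "i < n" for i
    using that \<phi>0 \<phi>n by (cases "Suc i = n") auto
  have \<phi>lo: "0 \<le> \<phi> i" if "i \<le> n" for i
    unfolding \<phi>_def using low[OF that] by (metis diff_ge_0_iff_ge of_nat_le_iff of_nat_mult)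
  have \<phi>hi: "\<phi> i < int n" if "i \<le> n" for i
  proof -
    have "int (\<Sum>j<i. w j) < int (k * i + n)" using high[OF that] by (subst of_nat_less_iff)
    then show ?thesis by (simp add: \<phi>_def)
  qed
  have \<phi>step: "\<phi> (Suc i) = \<phi> i + int (w i) - int k" for i by (simp add: \<phi>_def algebra_simps)
  let ?I = "\<lambda>P. if P then 1 else (0::int)"
  \<comment> \<open>\<open>c1 i\<close> and \<open>c2 t\<close> are the parts of the weight of a
    cycle edge and of a chord that arrive in \<open>S\<close>.\<close>
  define c1 where "c1 i = (int n - \<phi> (Suc i)) * ?I (i \<in> S) + \<phi> (Suc i mod n) * ?I (Suc i mod n \<in> S)" for i
  define c2 where "c2 t = int \<alpha> * ?I (f t \<in> S) + int \<beta> * ?I (g t \<in> S)" for t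
  have c1: "int n * ?I (i \<in> S \<and> Suc i mod n \<in> S) \<le> c1 i" if "i < n" for i
    using \<phi>lo[of "Suc i"] \<phi>hi[of "Suc i"] that by (auto simp: c1_def \<phi>mod)
  \<comment> \<open>The cycle edge that leaves \<open>S\<close> at \<open>i0\<close> does not lie
    inside \<open>S\<close> but still gives \<open>n - \<phi> (i0 + 1) > 0\<close> to it. This is
    the source of strictness.\<close>
  obtain i0 where i0: "i0 \<in> S" "Suc i0 mod n \<notin> S" using cyclic_boundary[OF S] by blast
  then have i0n: "i0 < n" using S by auto
  have c1': "int n * ?I (i0 \<in> S \<and> Suc i0 mod n \<in> S) < c1 i0"
    using i0 i0n \<phi>hi[of "Suc i0"] by (simp add: c1_def)
  have "int n * int (card {i \<in> {..<n}. i \<in> S \<and> Suc i mod n \<in> S}) = (\<Sum>i<n. int n * ?I (i \<in> S \<and> Suc i mod n \<in> S))"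
    by (simp add: sum_distrib_left[symmetric] sum.If_cases Int_def)
  also have "\<dots> < (\<Sum>i<n. c1 i)"
  proof (rule sum_strict_mono_ex1)
    show "\<exists>i\<in>{..<n}. int n * ?I (i \<in> S \<and> Suc i mod n \<in> S) < c1 i"
      using c1' i0n by (intro bexI[of _ i0]) auto
  qed (use c1 in auto)
  \<comment> \<open>The cyclic shift regroups the shares by receiver: vertex \<open>i\<close> keeps
    \<open>n - \<phi> (i + 1)\<close> of its outgoing edge and gets \<open>\<phi> i\<close> from the
    incoming one, together \<open>n + k - w i\<close>.\<close>
  also have "\<dots> = (\<Sum>i<n. (int n - \<phi> (Suc i)) * ?I (i \<in> S)) + (\<Sum>i<n. \<phi> i * ?I (i \<in> S))"
    unfolding c1_def sum.distrib using sum_Suc_mod[of "\<lambda>i. \<phi> i * ?I (i \<in> S)" n] by simp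
  also have "\<dots> = (\<Sum>i<n. (int n + int k - int (w i)) * ?I (i \<in> S))"
    by (simp add: sum.distrib[symmetric] \<phi>step algebra_simps)
  also have "\<dots> = (\<Sum>i\<in>S. int n + int k - int (w i))"
    using S by (simp add: if_distrib sum.If_cases Int_absorb1 cong: if_cong)
  also have "\<dots> = (int n + int k) * int (card S) - (\<Sum>i\<in>S. int (w i))"
    by (simp add: sum_subtractf)
  finally have A: "int n * int (card {i \<in> {..<n}. i \<in> S \<and> Suc i mod n \<in> S}) < (int n + int k) * int (card S) - (\<Sum>i\<in>S. int (w i))" .
  have "int n * int (card {t \<in> {..<k}. f t \<in> S \<and> g t \<in> S}) = (\<Sum>t<k. int n * ?I (f t \<in> S \<and> g t \<in> S))"
    by (simp add: sum_distrib_left[symmetric] sum.If_cases Int_def)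
  also have "\<dots> \<le> (\<Sum>t<k. c2 t)"
    by (rule sum_mono) (use weights in \<open>auto simp: c2_def\<close>)
  also have "\<dots> = int \<alpha> * int (card {t \<in> {..<k}. f t \<in> S}) + int \<beta> * int (card {t \<in> {..<k}. g t \<in> S})"
    unfolding c2_def sum.distrib by (simp add: sum_distrib_left[symmetric] sum.If_cases Int_def)
  also have "\<dots> = (\<Sum>i\<in>S. int (w i))"
    unfolding sum_card_fibres[OF finS, symmetric] by (simp add: w_def sum.distrib sum_distrib_left)
  finally have "int n * (int (card {i \<in> {..<n}. i \<in> S \<and> Suc i mod n \<in> S}) + int (card {t \<in> {..<k}. f t \<in> S \<and> g t \<in> S}))
    < (int n + int k) * int (card S)" using A by (simp add: algebra_simps)
  then have "int (n * (card {i \<in> {..<n}. i \<in> S \<and> Suc i mod n \<in> S} + card {t \<in> {..<k}. f t \<in> S \<and> g t \<in> S})) < int ((n + k) * card S)"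
    by (simp only: of_nat_mult of_nat_add)
  then show ?thesis by (simp only: of_nat_less_iff)
qed

section \<open>Relabelling and walks\<close>

definition relabel :: "('a \<Rightarrow> 'b) \<Rightarrow> 'a graph \<Rightarrow> 'b graph" where
  "relabel h G = (h ` verts G, (`) h ` edges G)"

lemma simple_graph_relabel:
  assumes "simple_graph G" "inj_on h (verts G)"
  shows "simple_graph (relabel h G)"
proof -
  have "card (h ` e) = 2" if "e \<in> edges G" for e
    using assms that card_image[OF inj_on_subset[OF assms(2)], of e] by (auto simp: simple_graph_def)
  then show ?thesis using assms by (auto simp: simple_graph_def relabel_def)
qed

lemma card_edges_relabel:
  assumes "simple_graph G" "inj_on h (verts G)"
  shows "card (edges (relabel h G)) = card (edges G)"
proof -
  have "edges G \<subseteq> Pow (verts G)" using assms by (auto simp: simple_graph_def)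
  then show ?thesis unfolding relabel_def snd_conv
    by (intro card_image inj_on_subset[OF inj_on_image_Pow[OF assms(2)]])
qed

lemma strictly_balanced_relabelI:
  assumes G: "simple_graph G" and h: "inj_on h (verts G)"
    and sparse: "\<And>S. S \<subseteq> verts G \<Longrightarrow> S \<noteq> {} \<Longrightarrow> S \<noteq> verts G \<Longrightarrow>
      card (verts G) * card {e \<in> edges G. e \<subseteq> S} < card (edges G) * card S"
  shows "strictly_balanced (relabel h G)"
proof (rule strictly_balancedI)
  show "simple_graph (relabel h G)" by (rule simple_graph_relabel[OF G h])
next
  fix S assume S: "S \<subseteq> verts (relabel h G)" "S \<noteq> {}" "S \<noteq> verts (relabel h G)"
  define T where "T = {x \<in> verts G. h x \<in> S}"
  have TS: "h ` T = S" using S by (auto simp: T_def relabel_def)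
  have T: "T \<subseteq> verts G" "T \<noteq> {}" "T \<noteq> verts G" using S TS by (auto simp: T_def relabel_def)
  have cT: "card S = card T" using card_image[OF inj_on_subset[OF h T(1)]] TS by simp
  have cV: "card (verts (relabel h G)) = card (verts G)" by (simp add: relabel_def card_image[OF h])
  have sub: "e \<subseteq> verts G" if "e \<in> edges G" for e using G that by (auto simp: simple_graph_def)
  have "{e \<in> edges (relabel h G). e \<subseteq> S} \<subseteq> (`) h ` {e \<in> edges G. e \<subseteq> T}"
    using sub by (fastforce simp: relabel_def T_def)
  then have "card {e \<in> edges (relabel h G). e \<subseteq> S} \<le> card {e \<in> edges G. e \<subseteq> T}"
    using finite_edges[OF G] by (intro surj_card_le) simp_all
  then show "card (verts (relabel h G)) * card {e \<in> edges (relabel h G). e \<subseteq> S}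
      < card (edges (relabel h G)) * card S"
    using sparse[OF T] unfolding cV cT card_edges_relabel[OF G h] by (meson le_less_trans mult_le_mono2)
qed

lemma edge_relabel_iff:
  assumes "simple_graph G" "inj_on h (verts G)" "u \<in> verts G" "v \<in> verts G"
  shows "{h u, h v} \<in> edges (relabel h G) \<longleftrightarrow> {u, v} \<in> edges G"
proof
  assume "{h u, h v} \<in> edges (relabel h G)"
  then obtain e where e: "e \<in> edges G" "h ` e = h ` {u, v}" by (auto simp: relabel_def)
  have "e \<subseteq> verts G" using e assms by (auto simp: simple_graph_def)
  then have "e = {u, v}" using e(2) inj_on_image_eq_iff[OF assms(2)] assms(3,4) by blast
  then show "{u, v} \<in> edges G" using e by simp
next
  assume "{u, v} \<in> edges G"
  then have "h ` {u, v} \<in> (`) h ` edges G" by (rule imageI)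
  then show "{h u, h v} \<in> edges (relabel h G)" by (simp add: relabel_def)
qed

text \<open>Conjugation by \<open>h\<close> turns an automorphism of the relabelled graph into one
  of the original graph, so rigidity can be checked on the fixed positions.\<close>

lemma asymmetric_relabelI:
  assumes G: "simple_graph G" and h: "inj_on h (verts G)"
    and rigid: "\<And>\<psi>. bij_betw \<psi> (verts G) (verts G) \<Longrightarrow>
      (\<And>u v. u \<in> verts G \<Longrightarrow> v \<in> verts G \<Longrightarrow> {\<psi> u, \<psi> v} \<in> edges G \<longleftrightarrow> {u, v} \<in> edges G) \<Longrightarrow>
      \<forall>v\<in>verts G. \<psi> v = v"
  shows "asymmetric (relabel h G)"
proof -
  let ?V = "verts G"
  have "\<phi> = id" if \<phi>: "\<phi> \<in> automorphisms (relabel h G)" for \<phi>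
  proof -
    have perm: "\<phi> permutes h ` ?V" using \<phi> by (auto simp: automorphisms_def relabel_def)
    have pres: "{\<phi> x, \<phi> y} \<in> edges (relabel h G) \<longleftrightarrow> {x, y} \<in> edges (relabel h G)"
      if "x \<in> h ` ?V" "y \<in> h ` ?V" for x y
      using \<phi> that by (auto simp: automorphisms_def relabel_def)
    define \<psi> where "\<psi> = inv_into ?V h \<circ> (\<phi> \<circ> h)"
    have bij: "bij_betw h ?V (h ` ?V)" using h by (simp add: bij_betw_def)
    have b: "bij_betw \<psi> ?V ?V" unfolding \<psi>_def
      by (intro bij_betw_trans[OF bij_betw_trans[OF bij permutes_imp_bij[OF perm]]] bij_betw_inv_into bij)
    have h\<psi>: "h (\<psi> v) = \<phi> (h v)" if "v \<in> ?V" for v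
      unfolding \<psi>_def comp_def
      by (rule f_inv_into_f) (use that permutes_in_image[OF perm] in blast)
    have "\<forall>v\<in>?V. \<psi> v = v"
    proof (rule rigid[OF b])
      fix u v assume uv: "u \<in> ?V" "v \<in> ?V"
      have "\<psi> u \<in> ?V" "\<psi> v \<in> ?V" using bij_betwE[OF b] uv by auto
      then have "{\<psi> u, \<psi> v} \<in> edges G \<longleftrightarrow> {h (\<psi> u), h (\<psi> v)} \<in> edges (relabel h G)"
        using edge_relabel_iff[OF G h] by blast
      also have "\<dots> \<longleftrightarrow> {h u, h v} \<in> edges (relabel h G)" using pres uv by (simp add: h\<psi>)
      also have "\<dots> \<longleftrightarrow> {u, v} \<in> edges G" using edge_relabel_iff[OF G h] uv by blast
      finally show "{\<psi> u, \<psi> v} \<in> edges G \<longleftrightarrow> {u, v} \<in> edges G" .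
    qed
    then have "\<phi> x = x" if "x \<in> h ` ?V" for x using that h\<psi> by fastforce
    then show "\<phi> = id" using permutes_not_in[OF perm] by (metis eq_id_iff)
  qed
  moreover have "id \<in> automorphisms (relabel h G)" by (simp add: automorphisms_def permutes_id)
  ultimately show ?thesis unfolding asymmetric_def by blast
qed

text \<open>The modulus \<open>M = 0\<close> gives walks on a path, a positive modulus walks on a cycle.\<close>

lemma non_backtracking_walk:
  fixes x :: "nat \<Rightarrow> int"
  assumes step: "\<And>i. Suc i < L \<Longrightarrow> M dvd x (Suc i) - x i - 1 \<or> M dvd x (Suc i) - x i + 1"
    and nb: "\<And>i. Suc (Suc i) < L \<Longrightarrow> \<not> M dvd x (Suc (Suc i)) - x i"
  shows "\<exists>\<epsilon>\<in>{1, -1}. \<forall>i<L. M dvd x i - (x 0 + \<epsilon> * int i)"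
proof -
  have "\<exists>\<epsilon>\<in>{1, -1}. \<forall>i. Suc i < L \<longrightarrow> M dvd x (Suc i) - x i - \<epsilon>"
  proof (cases "Suc 0 < L")
    case True
    then obtain \<epsilon> where \<epsilon>: "\<epsilon> \<in> {1, -1}" "M dvd x (Suc 0) - x 0 - \<epsilon>" using step[of 0] by (metis diff_minus_eq_add insertI1 insertI2)
    have "M dvd x (Suc i) - x i - \<epsilon>" if "Suc i < L" for i
      using that
    proof (induction i)
      case (Suc i)
      then have IH: "M dvd x (Suc i) - x i - \<epsilon>" by simp
      show ?case
      proof (rule ccontr)
        assume "\<not> ?case"
        \<comment> \<open>A change of direction would bring the walk back to \<open>x i\<close>
          modulo \<open>M\<close> after two steps.\<close>
        then have "M dvd x (Suc (Suc i)) - x (Suc i) + \<epsilon>" using step[OF Suc.prems] \<epsilon>(1) by auto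
        from dvd_add[OF this IH] nb[OF Suc.prems] show False by simp
      qed
    qed (use \<epsilon> in simp)
    then show ?thesis using \<epsilon>(1) by blast
  qed auto
  then obtain \<epsilon> where \<epsilon>: "\<epsilon> \<in> {1, -1}" "\<And>i. Suc i < L \<Longrightarrow> M dvd x (Suc i) - x i - \<epsilon>" by blast
  have "M dvd x i - (x 0 + \<epsilon> * int i)" if "i < L" for i
    using that
  proof (induction i)
    case (Suc i)
    from dvd_add[OF \<epsilon>(2)[OF Suc.prems] Suc.IH] Suc.prems show ?case by (simp add: algebra_simps)
  qed simp
  then show ?thesis using \<epsilon>(1) by blast
qed

text \<open>By injectivity the walk never backtracks, so it has constant slope 1 or -1. The images
  of the first and the last point stay in the interval, which pins down the starting value.\<close>

lemma path_automorphism: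
  fixes \<psi> :: "nat \<Rightarrow> nat"
  assumes inj: "inj_on \<psi> {lo..<hi}" and ran: "\<And>i. i \<in> {lo..<hi} \<Longrightarrow> \<psi> i \<in> {lo..<hi}"
    and step: "\<And>i. lo \<le> i \<Longrightarrow> Suc i < hi \<Longrightarrow> \<psi> (Suc i) = Suc (\<psi> i) \<or> \<psi> i = Suc (\<psi> (Suc i))"
  shows "(\<forall>i\<in>{lo..<hi}. \<psi> i = i) \<or> (\<forall>i\<in>{lo..<hi}. \<psi> i + Suc i = lo + hi)"
proof (cases "lo < hi")
  case True
  have "\<exists>\<epsilon>\<in>{1, -1}. \<forall>i<hi - lo. 0 dvd int (\<psi> (lo + i)) - (int (\<psi> (lo + 0)) + \<epsilon> * int i)"
  proof (rule non_backtracking_walk)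
    fix i assume "Suc i < hi - lo"
    then show "0 dvd int (\<psi> (lo + Suc i)) - int (\<psi> (lo + i)) - 1 \<or>
        0 dvd int (\<psi> (lo + Suc i)) - int (\<psi> (lo + i)) + 1"
      using step[of "lo + i"] by auto
  next
    fix i assume "Suc (Suc i) < hi - lo"
    then show "\<not> 0 dvd int (\<psi> (lo + Suc (Suc i))) - int (\<psi> (lo + i))"
      using inj_onD[OF inj, of "lo + Suc (Suc i)" "lo + i"] by (auto simp: less_diff_conv add.commute)
  qed
  then obtain \<epsilon> :: int where \<epsilon>1: "\<epsilon> \<in> {1, -1}"
    and "\<forall>i<hi - lo. 0 dvd int (\<psi> (lo + i)) - (int (\<psi> (lo + 0)) + \<epsilon> * int i)" by blast
  then have \<epsilon>: "int (\<psi> (lo + i)) = int (\<psi> lo) + \<epsilon> * int i" if "i < hi - lo" for i using that by simp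
  define j where "j = hi - lo - 1"
  have j: "lo + j < hi" "hi = lo + j + 1" using True by (auto simp: j_def)
  have lo': "lo \<le> \<psi> lo" "\<psi> lo < hi" "lo \<le> \<psi> (lo + j)" "\<psi> (lo + j) < hi" using ran[of lo] ran[of "lo + j"] True j by auto
  have e: "int (\<psi> i) = int (\<psi> lo) + \<epsilon> * (int i - int lo)" if "i \<in> {lo..<hi}" for i
    using \<epsilon>[of "i - lo"] that by (auto simp: of_nat_diff)
  have ej: "int (\<psi> (lo + j)) = int (\<psi> lo) + \<epsilon> * int j" using \<epsilon>[of j] j by auto
  from \<epsilon>1 consider "\<epsilon> = 1" | "\<epsilon> = -1" by blast
  then show ?thesis
  proof cases
    case 1
    then have "\<psi> lo = lo" using ej lo' j by auto
    then have "\<psi> i = i" if "i \<in> {lo..<hi}" for i using e[OF that] 1 by auto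
    then show ?thesis by blast
  next
    case 2
    then have "\<psi> lo = lo + j" using ej lo' j by auto
    then have "\<psi> i + Suc i = lo + hi" if "i \<in> {lo..<hi}" for i using e[OF that] 2 j by auto
    then show ?thesis by blast
  qed
qed simp

section \<open>A cycle with chords between two arcs\<close>

text \<open>The positions below \<open>a\<close> form one arc (the long one in the application), the
  remaining positions the other. The last two assumptions keep chords from doubling one of the two
  cycle edges that join the arcs.\<close>

locale cycle_with_chords =
  fixes n a k :: nat and f g :: "nat \<Rightarrow> nat"
  assumes a_ge: "2 \<le> a" and a_le: "a + 2 \<le> n"
    and f_less: "\<And>t. t < k \<Longrightarrow> f t < a"
    and g_ge: "\<And>t. t < k \<Longrightarrow> a \<le> g t" and g_less: "\<And>t. t < k \<Longrightarrow> g t < n"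
    and inj_ends: "inj_on (\<lambda>t. (f t, g t)) {..<k}"
    and no_first: "\<And>t. t < k \<Longrightarrow> (f t, g t) \<noteq> (a - 1, a)"
    and no_last: "\<And>t. t < k \<Longrightarrow> (f t, g t) \<noteq> (0, n - 1)"
begin

definition E :: "nat set set" where
  "E = (\<lambda>i. {i, Suc i mod n}) ` {..<n} \<union> (\<lambda>t. {f t, g t}) ` {..<k}"

definition cyc :: "nat \<Rightarrow> nat \<Rightarrow> bool" where
  "cyc u v \<longleftrightarrow> Suc u mod n = v \<or> Suc v mod n = u"

definition nbrs :: "nat \<Rightarrow> nat set" where
  "nbrs v = {u. u < n \<and> {u, v} \<in> E}"

definition deg :: "nat \<Rightarrow> nat" where
  "deg v = card (nbrs v)"

lemma n_gt: "3 < n" using a_ge a_le by simp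

lemma Suc_mod: "i < n \<Longrightarrow> Suc i mod n = (if Suc i = n then 0 else Suc i)" by auto

lemma edge_iff:
  assumes "u < n" "v < n"
  shows "{u, v} \<in> E \<longleftrightarrow> cyc u v \<or> (\<exists>t<k. u = f t \<and> v = g t) \<or> (\<exists>t<k. u = g t \<and> v = f t)"
  using assms unfolding E_def cyc_def by (auto simp: doubleton_eq_iff)

lemma chord_not_cyc:
  assumes "t < k"
  shows "\<not> cyc (f t) (g t)"
  using f_less[OF assms] g_ge[OF assms] g_less[OF assms] no_first[OF assms] no_last[OF assms] a_le
  by (auto simp: cyc_def Suc_mod split: if_splits)

lemma simple_E: "simple_graph ({..<n}, E)"
proof -
  have "card {i, Suc i mod n} = 2" if "i < n" for i using that n_gt by (auto simp: Suc_mod)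
  moreover have "card {f t, g t} = 2" if "t < k" for t
    using f_less[OF that] g_ge[OF that] by simp
  moreover have "f t < n" if "t < k" for t using f_less[OF that] a_le by simp
  ultimately show ?thesis using g_less n_gt by (auto simp: simple_graph_def E_def)
qed

lemma card_E: "card E = n + k"
proof -
  have 1: "inj_on (\<lambda>i. {i, Suc i mod n}) {..<n}"
    using n_gt by (auto simp: inj_on_def doubleton_eq_iff Suc_mod split: if_splits)
  have 2: "inj_on (\<lambda>t. {f t, g t}) {..<k}"
  proof (rule inj_onI)
    fix t t' assume t: "t \<in> {..<k}" "t' \<in> {..<k}" "{f t, g t} = {f t', g t'}"
    then have "(f t, g t) = (f t', g t')"
      using f_less[of t] g_ge[of t] f_less[of t'] g_ge[of t'] by (auto simp: doubleton_eq_iff)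
    then show "t = t'" using inj_onD[OF inj_ends] t by blast
  qed
  have "{i, Suc i mod n} \<noteq> {f t, g t}" if "t < k" for i t
    using chord_not_cyc[OF that] by (auto simp: doubleton_eq_iff cyc_def)
  then have "(\<lambda>i. {i, Suc i mod n}) ` {..<n} \<inter> (\<lambda>t. {f t, g t}) ` {..<k} = {}" by blast
  then show ?thesis unfolding E_def by (simp add: card_Un_disjoint card_image 1 2)
qed

lemma card_cyclic_nbrs:
  assumes "v < n"
  shows "card {u. u < n \<and> cyc u v} = 2"
proof -
  have "u < n \<and> cyc u v \<longleftrightarrow> u = Suc v mod n \<or> u = (if v = 0 then n - 1 else v - 1)" for u
  proof (cases "u < n")
    case True
    then show ?thesis unfolding cyc_def Suc_mod[OF assms] Suc_mod[OF True] using assms n_gt by auto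
  next
    case False
    then show ?thesis using Suc_mod[OF assms] assms n_gt by auto
  qed
  then have "{u. u < n \<and> cyc u v} = {Suc v mod n, (if v = 0 then n - 1 else v - 1)}" by blast
  moreover have "Suc v mod n \<noteq> (if v = 0 then n - 1 else v - 1)"
    using assms n_gt by (auto simp: Suc_mod)
  ultimately show ?thesis by simp
qed

lemma deg_low:
  assumes v: "v < a"
  shows "deg v = 2 + card {t \<in> {..<k}. f t = v}"
proof -
  have vn: "v < n" using v a_le by simp
  have "nbrs v = {u. u < n \<and> cyc u v} \<union> g ` {t \<in> {..<k}. f t = v}"
    using v vn g_ge g_less by (force simp: nbrs_def edge_iff)
  moreover have "{u. u < n \<and> cyc u v} \<inter> g ` {t \<in> {..<k}. f t = v} = {}"
    using chord_not_cyc by (auto simp: cyc_def)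
  moreover have "inj_on g {t \<in> {..<k}. f t = v}"
    using inj_ends by (auto simp: inj_on_def)
  ultimately show ?thesis unfolding deg_def using card_cyclic_nbrs[OF vn]
    by (simp add: card_Un_disjoint card_image)
qed

lemma deg_high:
  assumes v: "a \<le> v" "v < n"
  shows "deg v = 2 + card {t \<in> {..<k}. g t = v}"
proof -
  have "f t < n" if "t < k" for t using f_less[OF that] a_le by simp
  then have "nbrs v = {u. u < n \<and> cyc u v} \<union> f ` {t \<in> {..<k}. g t = v}"
    using v f_less by (force simp: nbrs_def edge_iff)
  moreover have "{u. u < n \<and> cyc u v} \<inter> f ` {t \<in> {..<k}. g t = v} = {}"
    using chord_not_cyc by auto
  moreover have "inj_on f {t \<in> {..<k}. g t = v}"
    using inj_ends by (auto simp: inj_on_def)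
  ultimately show ?thesis unfolding deg_def using card_cyclic_nbrs[OF v(2)]
    by (simp add: card_Un_disjoint card_image)
qed

text \<open>With chord weights \<open>a\<close> and \<open>n - a\<close>, each arc separately
  receives \<open>k\<close> per vertex on average. The condition on prefix sums therefore splits
  into one on the low ends and one on the high ends.\<close>

lemma sparse:
  assumes A: "\<And>i. i \<le> a \<Longrightarrow> k * i \<le> a * card {t \<in> {..<k}. f t < i}"
      "\<And>i. i \<le> a \<Longrightarrow> a * card {t \<in> {..<k}. f t < i} < k * i + n"
    and B: "\<And>i. i \<le> n - a \<Longrightarrow> k * i \<le> (n - a) * card {t \<in> {..<k}. g t < a + i}"
      "\<And>i. i \<le> n - a \<Longrightarrow> (n - a) * card {t \<in> {..<k}. g t < a + i} < k * i + n"
    and S: "S \<subseteq> {..<n}" "S \<noteq> {}" "S \<noteq> {..<n}"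
  shows "n * card {e \<in> E. e \<subseteq> S} < (n + k) * card S"
proof -
  let ?w = "\<lambda>i. a * card {t \<in> {..<k}. f t = i} + (n - a) * card {t \<in> {..<k}. g t = i}"
  have w: "(\<Sum>j<i. ?w j) = a * card {t \<in> {..<k}. f t < i} + (n - a) * card {t \<in> {..<k}. g t < i}" for i
    using sum_card_fibres[of "{..<i}" k f] sum_card_fibres[of "{..<i}" k g]
    by (simp add: sum.distrib sum_distrib_left[symmetric])
  have bounds: "k * i \<le> (\<Sum>j<i. ?w j) \<and> (\<Sum>j<i. ?w j) < k * i + n" if "i \<le> n" for i
  proof (cases "i \<le> a")
    case True
    then have "{t \<in> {..<k}. g t < i} = {}" using g_ge by fastforce
    then have "card {t \<in> {..<k}. g t < i} = 0" by (simp only: card.empty)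
    then show ?thesis using A[OF True] unfolding w by (simp only: mult_0_right add_0_right)
  next
    case False
    define j where "j = i - a"
    have j: "i = a + j" "j \<le> n - a" using False that by (auto simp: j_def)
    \<comment> \<open>Beyond position \<open>a\<close> all low ends have been counted. They
      contribute exactly \<open>a * k\<close>, which cancels against the first \<open>a\<close>
      positions.\<close>
    have "{t \<in> {..<k}. f t < i} = {..<k}" using f_less False by fastforce
    then show ?thesis using B[OF j(2)] unfolding w j(1) by (simp add: algebra_simps)
  qed
  have "{e \<in> E. e \<subseteq> S} \<subseteq> (\<lambda>i. {i, Suc i mod n}) ` {i \<in> {..<n}. i \<in> S \<and> Suc i mod n \<in> S} \<union>
      (\<lambda>t. {f t, g t}) ` {t \<in> {..<k}. f t \<in> S \<and> g t \<in> S}" (is "_ \<subseteq> ?X ` ?C \<union> ?Y ` ?D")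
    by (auto simp: E_def)
  then have "card {e \<in> E. e \<subseteq> S} \<le> card (?X ` ?C \<union> ?Y ` ?D)" by (intro card_mono) auto
  also have "\<dots> \<le> card (?X ` ?C) + card (?Y ` ?D)" by (rule card_Un_le)
  also have "\<dots> \<le> card ?C + card ?D" by (intro add_mono card_image_le) auto
  finally have "n * card {e \<in> E. e \<subseteq> S} \<le> n * (card ?C + card ?D)" by simp
  also have "\<dots> < (n + k) * card S"
  proof (rule cycle_with_chords_sparse[where \<alpha> = a and \<beta> = "n - a", OF _ _ _ _ S])
    show "a + (n - a) = n" using a_le by simp
    show "f t < n \<and> g t < n" if "t < k" for t using f_less[OF that] g_less[OF that] a_le by simp
    show "k * i \<le> (\<Sum>j<i. ?w j)" if "i \<le> n" for i using bounds[OF that] by (rule conjunct1)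
    show "(\<Sum>j<i. ?w j) < k * i + n" if "i \<le> n" for i using bounds[OF that] by (rule conjunct2)
  qed
  finally show ?thesis .
qed

section \<open>Automorphisms of a cycle with chords\<close>

context
  fixes \<psi> :: "nat \<Rightarrow> nat"
  assumes bij: "bij_betw \<psi> {..<n} {..<n}"
    and aut: "\<And>u v. u < n \<Longrightarrow> v < n \<Longrightarrow> {\<psi> u, \<psi> v} \<in> E \<longleftrightarrow> {u, v} \<in> E"
begin

lemma aut_less: "v < n \<Longrightarrow> \<psi> v < n" using bij_betwE[OF bij] by simp

lemma aut_inj: "inj_on \<psi> {..<n}" using bij by (simp add: bij_betw_def)

lemma deg_aut:
  assumes "v < n"
  shows "deg (\<psi> v) = deg v"
proof -
  have "nbrs (\<psi> v) = \<psi> ` nbrs v"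
  proof safe
    fix u assume u: "u \<in> nbrs (\<psi> v)"
    then obtain u' where u': "u' < n" "u = \<psi> u'" using bij by (auto simp: nbrs_def bij_betw_def)
    then show "u \<in> \<psi> ` nbrs v" using u aut assms by (auto simp: nbrs_def)
  qed (use aut aut_less assms in \<open>auto simp: nbrs_def\<close>)
  moreover have "inj_on \<psi> (nbrs v)" by (rule inj_on_subset[OF aut_inj]) (auto simp: nbrs_def)
  ultimately show ?thesis by (simp add: deg_def card_image)
qed

lemma edge_low: "u < a \<Longrightarrow> v < a \<Longrightarrow> {u, v} \<in> E \<longleftrightarrow> v = Suc u \<or> u = Suc v"
  using a_le edge_iff[of u v] g_ge by (force simp: cyc_def Suc_mod)

lemma edge_high: "a \<le> u \<Longrightarrow> u < n \<Longrightarrow> a \<le> v \<Longrightarrow> v < n \<Longrightarrow> {u, v} \<in> E \<longleftrightarrow> v = Suc u \<or> u = Suc v"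
  using a_ge edge_iff[of u v] f_less by (force simp: cyc_def Suc_mod)

text \<open>The degrees fix both arcs as sets, and each arc induces a path, so \<open>\<psi>\<close>
  is the identity or the reversal on each. Reversing exactly one arc sends a cycle edge between the
  arcs to the missing edge \<open>{a - 1, n - 1}\<close>; reversing both sends
  \<open>{x, n - 1}\<close> to the missing edge \<open>{a - 1 - x, a}\<close>.\<close>

lemma rigid_if_degrees_separate:
  assumes low: "\<And>v. v < a \<Longrightarrow> deg v \<le> D" and high: "\<And>v. a \<le> v \<Longrightarrow> v < n \<Longrightarrow> D < deg v"
    and no_corner: "{a - 1, n - 1} \<notin> E"
    and x: "x < a" "{x, n - 1} \<in> E" "{a - 1 - x, a} \<notin> E"
  shows "\<forall>v<n. \<psi> v = v"
proof -
  have A: "\<psi> v < a" if "v < a" for v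
    using low[OF that] high[of "\<psi> v"] deg_aut[of v] aut_less[of v] that a_le by fastforce
  have B: "a \<le> \<psi> v" if "a \<le> v" "v < n" for v
    using high[OF that] low[of "\<psi> v"] deg_aut[of v] that by fastforce
  have pA: "(\<forall>i\<in>{0..<a}. \<psi> i = i) \<or> (\<forall>i\<in>{0..<a}. \<psi> i + Suc i = 0 + a)"
  proof (rule path_automorphism)
    show "inj_on \<psi> {0..<a}" by (rule inj_on_subset[OF aut_inj]) (use a_le in auto)
    fix i assume i: "Suc i < a"
    then have "{i, Suc i} \<in> E" using edge_low by simp
    then have "{\<psi> i, \<psi> (Suc i)} \<in> E" using aut i a_le by simp
    then show "\<psi> (Suc i) = Suc (\<psi> i) \<or> \<psi> i = Suc (\<psi> (Suc i))"
      using edge_low[of "\<psi> i" "\<psi> (Suc i)"] A i by simp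
  qed (use A in auto)
  have pB: "(\<forall>i\<in>{a..<n}. \<psi> i = i) \<or> (\<forall>i\<in>{a..<n}. \<psi> i + Suc i = a + n)"
  proof (rule path_automorphism)
    show "inj_on \<psi> {a..<n}" by (rule inj_on_subset[OF aut_inj]) auto
    fix i assume i: "a \<le> i" "Suc i < n"
    then have "{i, Suc i} \<in> E" using edge_high by simp
    then have "{\<psi> i, \<psi> (Suc i)} \<in> E" using aut i a_le by simp
    then show "\<psi> (Suc i) = Suc (\<psi> i) \<or> \<psi> i = Suc (\<psi> (Suc i))"
      using edge_high[of "\<psi> i" "\<psi> (Suc i)"] B aut_less i by simp
  qed (use B aut_less in auto)
  have e1: "{a - 1, a} \<in> E" and e2: "{0, n - 1} \<in> E"
    using edge_iff[of "a - 1" a] edge_iff[of 0 "n - 1"] a_ge a_le by (auto simp: cyc_def)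
  have nA: "a - 1 \<in> {0..<a}" "0 \<in> {0..<a}" "x \<in> {0..<a}" and nB: "a \<in> {a..<n}" "n - 1 \<in> {a..<n}"
    using a_ge a_le x(1) by auto
  have lt: "a - 1 < n" "0 < n" "x < n" "a < n" "n - 1 < n" using a_ge a_le x(1) by auto
  consider (AB) "\<forall>i\<in>{0..<a}. \<psi> i = i" "\<forall>i\<in>{a..<n}. \<psi> i = i"
    | (A) "\<forall>i\<in>{0..<a}. \<psi> i = i" "\<forall>i\<in>{a..<n}. \<psi> i + Suc i = a + n"
    | (B) "\<forall>i\<in>{0..<a}. \<psi> i + Suc i = 0 + a" "\<forall>i\<in>{a..<n}. \<psi> i = i"
    | (none) "\<forall>i\<in>{0..<a}. \<psi> i + Suc i = 0 + a" "\<forall>i\<in>{a..<n}. \<psi> i + Suc i = a + n"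
    using pA pB by blast
  then show ?thesis
  proof cases
    case AB
    then show ?thesis by (metis atLeastLessThan_iff leI zero_le)
  next
    case A
    then have "\<psi> (a - 1) = a - 1" "\<psi> a + Suc a = a + n" using nA nB by blast+
    then have "\<psi> (a - 1) = a - 1" "\<psi> a = n - 1" by linarith+
    then show ?thesis using aut[OF lt(1,4)] e1 no_corner by simp
  next
    case B
    then have "\<psi> 0 + Suc 0 = 0 + a" "\<psi> (n - 1) = n - 1" using nA nB by blast+
    then have "\<psi> 0 = a - 1" "\<psi> (n - 1) = n - 1" by linarith+
    then show ?thesis using aut[OF lt(2,5)] e2 no_corner by simp
  next
    case none
    then have "\<psi> x + Suc x = 0 + a" "\<psi> (n - 1) + Suc (n - 1) = a + n" using nA nB by blast+
    then have "\<psi> x = a - 1 - x" "\<psi> (n - 1) = a" using lt by linarith+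
    then show ?thesis using aut[OF lt(3,5)] x by simp
  qed
qed

section \<open>Rigidity when degrees single out the chords\<close>

context
  assumes low: "\<And>v. v < a \<Longrightarrow> deg v \<le> 3" and last_low: "deg (a - 1) = 2" and first_low: "deg 0 = 3"
    and high: "\<And>v. a \<le> v \<Longrightarrow> v < n \<Longrightarrow> deg v \<noteq> 3"
begin

text \<open>Automorphisms preserve degrees and hence this relation, which serves to tell chords from
  cycle edges.\<close>

definition cross :: "nat \<Rightarrow> nat \<Rightarrow> bool" where
  "cross u v \<longleftrightarrow> deg u = 3 \<and> 3 < deg v \<or> 3 < deg u \<and> deg v = 3"

lemma two_le_deg: "v < n \<Longrightarrow> 2 \<le> deg v"
  using deg_low[of v] deg_high[of v] by (cases "v < a") auto

text \<open>Every chord joins degree 3 to degree greater than 3. No cycle edge does so, except that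
  \<open>{0, n - 1}\<close> does when \<open>n - 1\<close> carries a chord; at the other junction
  \<open>a - 1\<close> has degree 2. Deleting the crossing edges thus leaves the whole cycle or a
  Hamiltonian path.\<close>

lemma edge_not_cross_iff:
  assumes "u < n" "v < n"
  shows "{u, v} \<in> E \<and> \<not> cross u v \<longleftrightarrow>
    cyc u v \<and> (deg (n - 1) = 2 \<or> {u, v} \<noteq> {0, n - 1})"
proof -
  have chord: "cross (f t) (g t) \<and> cross (g t) (f t) \<and> {f t, g t} \<noteq> {0, n - 1}" if "t < k" for t
  proof -
    have "card {s \<in> {..<k}. f s = f t} \<noteq> 0" "card {s \<in> {..<k}. g s = g t} \<noteq> 0" using that by auto
    then have "deg (g t) \<noteq> 2" "deg (f t) = 3"
      using deg_low[OF f_less[OF that]] deg_high[OF g_ge[OF that] g_less[OF that]]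
        low[OF f_less[OF that]] by linarith+
    moreover have "deg (g t) \<noteq> 3" using high[OF g_ge[OF that] g_less[OF that]] by auto
    moreover have "2 \<le> deg (g t)" using two_le_deg[OF g_less[OF that]] .
    ultimately show ?thesis using no_last[OF that] f_less[OF that] a_le by (auto simp: cross_def doubleton_eq_iff)
  qed
  have step: "cross i (Suc i mod n) \<longleftrightarrow> deg (n - 1) \<noteq> 2 \<and> Suc i = n" if i: "i < n" for i
  proof -
    consider "Suc i < a" | "Suc i = a" | "a \<le> i" "Suc i < n" | "Suc i = n" using i by linarith
    then show ?thesis
    proof cases
      case 1
      then have "deg i \<in> {2, 3}" "deg (Suc i) \<in> {2, 3}"
        using low[of i] low[of "Suc i"] two_le_deg[of i] two_le_deg[of "Suc i"] a_le by auto
      then show ?thesis using 1 a_le i by (auto simp: cross_def)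
    next
      case 2
      then show ?thesis using last_low a_le by (auto simp: cross_def)
    next
      case 3
      then show ?thesis using high[of i] high[of "Suc i"] by (auto simp: cross_def)
    next
      case 4
      then have "i = n - 1" "a \<le> i" using a_le by auto
      then show ?thesis using 4 first_low high[of i] i two_le_deg[OF i] by (auto simp: cross_def)
    qed
  qed
  have sym: "cross u v \<longleftrightarrow> cross v u" by (auto simp: cross_def insert_commute)
  have cyc: "cross u v \<longleftrightarrow> deg (n - 1) \<noteq> 2 \<and> {u, v} = {0, n - 1}" if "cyc u v"
  proof -
    from that consider "Suc u mod n = v" | "Suc v mod n = u" by (auto simp: cyc_def)
    then show ?thesis
    proof cases
      case 1
      then show ?thesis using step[OF assms(1)] assms n_gt by (auto simp: doubleton_eq_iff Suc_mod split: if_splits)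
    next
      case 2
      then show ?thesis using step[OF assms(2)] assms n_gt unfolding sym by (auto simp: doubleton_eq_iff Suc_mod split: if_splits)
    qed
  qed
  show ?thesis
  proof (cases "cyc u v")
    case True
    then have "{u, v} \<in> E" using edge_iff[OF assms] by simp
    then show ?thesis using cyc[OF True] True by metis
  next
    case False
    then have "cross u v" if "{u, v} \<in> E" using that edge_iff[OF assms] chord by metis
    then show ?thesis using False by metis
  qed
qed

lemma cross_aut: "u < n \<Longrightarrow> v < n \<Longrightarrow> cross (\<psi> u) (\<psi> v) \<longleftrightarrow> cross u v"
  by (simp add: cross_def deg_aut)

lemma aut_step:
  assumes "u < n" "v < n" "cyc u v" "deg (n - 1) = 2 \<or> {u, v} \<noteq> {0, n - 1}"
  shows "cyc (\<psi> u) (\<psi> v) \<and> (deg (n - 1) = 2 \<or> {\<psi> u, \<psi> v} \<noteq> {0, n - 1})"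
  using edge_not_cross_iff[OF assms(1,2)] edge_not_cross_iff[OF aut_less aut_less, OF assms(1,2)]
    cross_aut[OF assms(1,2)] aut[OF assms(1,2)] assms(3,4) by blast

text \<open>The remaining edges form a path from 0 to \<open>n - 1\<close>. Its reversal is
  impossible, because 0 has degree 3 and \<open>n - 1\<close> does not.\<close>

lemma rigid_path:
  assumes "deg (n - 1) \<noteq> 2"
  shows "\<forall>v<n. \<psi> v = v"
proof -
  have "(\<forall>i\<in>{0..<n}. \<psi> i = i) \<or> (\<forall>i\<in>{0..<n}. \<psi> i + Suc i = 0 + n)"
  proof (rule path_automorphism)
    show "inj_on \<psi> {0..<n}" using aut_inj by (simp add: lessThan_atLeast0)
    fix i assume i: "Suc i < n"
    have "{i, Suc i} \<noteq> {0, n - 1}" using i n_gt by (auto simp: doubleton_eq_iff)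
    moreover have "cyc i (Suc i)" using i by (simp add: cyc_def)
    ultimately have "cyc (\<psi> i) (\<psi> (Suc i)) \<and> {\<psi> i, \<psi> (Suc i)} \<noteq> {0, n - 1}"
      using aut_step[of i "Suc i"] assms i by simp
    then show "\<psi> (Suc i) = Suc (\<psi> i) \<or> \<psi> i = Suc (\<psi> (Suc i))"
      using i aut_less[of i] aut_less[of "Suc i"]
      by (auto simp: cyc_def Suc_mod doubleton_eq_iff split: if_splits)
  qed (use aut_less in auto)
  moreover have "\<psi> 0 + Suc 0 \<noteq> 0 + n"
  proof
    assume "\<psi> 0 + Suc 0 = 0 + n"
    then have "\<psi> 0 = n - 1" by simp
    moreover have "a \<le> n - 1" "n - 1 < n" using a_le by auto
    ultimately show False using deg_aut[of 0] first_low high[of "n - 1"] by simp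
  qed
  ultimately show ?thesis using n_gt by fastforce
qed

text \<open>Here \<open>\<psi>\<close> is a rotation or a reflection of the cycle. Degrees force
  \<open>v = \<psi> 0\<close> into the long arc and \<open>y = \<psi> (n - d)\<close> into the short
  one. A reflection gives \<open>y = v + d\<close> modulo \<open>n\<close>, but \<open>v + d\<close>
  is still in the long arc. A rotation gives \<open>y = v - d\<close> modulo \<open>n\<close>, which
  requires \<open>v < d\<close> and hence \<open>v = 0\<close>.\<close>

lemma rigid_cycle:
  assumes two: "deg (n - 1) = 2"
    and d: "0 < d" "d \<le> n - a" "deg (n - d) \<noteq> 2"
    and gap: "\<And>v. v < a \<Longrightarrow> deg v = 3 \<Longrightarrow> v = 0 \<or> d \<le> v" "\<And>v. v < a \<Longrightarrow> deg v = 3 \<Longrightarrow> v + d < a"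
  shows "\<forall>v<n. \<psi> v = v"
proof -
  have "\<exists>\<epsilon>\<in>{1, -1}. \<forall>i<n. int n dvd int (\<psi> i) - (int (\<psi> 0) + \<epsilon> * int i)"
  proof (rule non_backtracking_walk)
    fix i assume i: "Suc i < n"
    have "cyc (\<psi> i) (\<psi> (Suc i))" using aut_step[of i "Suc i"] i two by (simp add: cyc_def)
    then have "\<psi> (Suc i) = Suc (\<psi> i) \<or> \<psi> i = Suc (\<psi> (Suc i)) \<or>
        Suc (\<psi> i) = n \<and> \<psi> (Suc i) = 0 \<or> Suc (\<psi> (Suc i)) = n \<and> \<psi> i = 0"
      using i aut_less[of i] aut_less[of "Suc i"] by (auto simp: cyc_def Suc_mod split: if_splits)
    then have "int (\<psi> (Suc i)) - int (\<psi> i) - 1 = 0 \<or> int (\<psi> (Suc i)) - int (\<psi> i) + 1 = 0 \<or>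
        int (\<psi> (Suc i)) - int (\<psi> i) - 1 = - int n \<or> int (\<psi> (Suc i)) - int (\<psi> i) + 1 = int n" by linarith
    then show "int n dvd int (\<psi> (Suc i)) - int (\<psi> i) - 1 \<or> int n dvd int (\<psi> (Suc i)) - int (\<psi> i) + 1"
      by (metis dvd_0_right dvd_minus_iff dvd_refl)
  next
    fix i assume i: "Suc (Suc i) < n"
    have "\<psi> (Suc (Suc i)) \<noteq> \<psi> i" using inj_onD[OF aut_inj, of "Suc (Suc i)" i] i by auto
    then show "\<not> int n dvd int (\<psi> (Suc (Suc i))) - int (\<psi> i)"
      using aut_less[of "Suc (Suc i)"] aut_less[of i] i by (simp add: mod_eq_dvd_iff[symmetric])
  qed
  then obtain \<epsilon> :: int where \<epsilon>: "\<epsilon> \<in> {1, -1}"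
    and walk: "\<forall>i<n. int n dvd int (\<psi> i) - (int (\<psi> 0) + \<epsilon> * int i)" by blast
  define v y where "v = \<psi> 0" and "y = \<psi> (n - d)"
  have v: "deg v = 3" "v < a" using deg_aut[of 0] first_low n_gt high[of v] aut_less[of 0]
    by (auto simp: v_def not_le[symmetric])
  have nd: "a \<le> n - d" "n - d < n" using d n_gt by auto
  have "3 < deg y" using deg_aut[OF nd(2)] d(3) high[OF nd] two_le_deg[OF nd(2)] by (simp add: y_def)
  then have y: "a \<le> y" "y < n" using low[of y] aut_less[OF nd(2)] by (auto simp: y_def not_less[symmetric])
  have dvd: "int n dvd int y - (int v + \<epsilon> * (int n - int d))"
    using walk[rule_format, OF nd(2)] d by (simp add: v_def y_def of_nat_diff)
  have "\<epsilon> \<noteq> -1"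
  proof
    assume "\<epsilon> = -1"
    then have "int n dvd int y - int v - int d + int n" using dvd by (simp add: algebra_simps)
    then have "int n dvd int y - int v - int d" by simp
    moreover have "0 < int y - int v - int d" using gap(2)[OF v(2,1)] y by simp
    ultimately have "int n \<le> int y - int v - int d" by (rule zdvd_imp_le)
    then show False using y by simp
  qed
  then have \<epsilon>1: "\<epsilon> = 1" using \<epsilon> by simp
  then have "int n dvd int y - int v + int d - int n" using dvd by (simp add: algebra_simps)
  from dvd_add[OF this dvd_refl] have "int n dvd int y - int v + int d" by simp
  moreover have "0 < int y - int v + int d" using v y by simp
  ultimately have "int n \<le> int y - int v + int d" by (rule zdvd_imp_le)
  then have "v < d" using y by simp
  then have "v = 0" using gap(1)[OF v(2,1)] by simp
  then have w: "int n dvd int (\<psi> i) - int i" if "i < n" for i using walk that \<epsilon>1 by (simp add: v_def)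
  have "\<psi> i = i" if i: "i < n" for i
  proof -
    have "int (\<psi> i) mod int n = int i mod int n" using w[OF i] by (simp add: mod_eq_dvd_iff)
    then show ?thesis using i aut_less[OF i] by simp
  qed
  then show ?thesis by blast
qed

end
end
end

section \<open>Evenly spread chord ends\<close>

text \<open>\<open>(N + b - 1) div b\<close> is the ceiling of \<open>N / b\<close>, equivalently
  the number of nonnegative multiples of \<open>b\<close> below \<open>N\<close>.\<close>

lemma ceiling_div_bounds:
  fixes N b :: nat
  assumes "0 < b"
  shows "N \<le> (N + b - 1) div b * b" "(N + b - 1) div b * b < N + b"
    "l * b < N \<longleftrightarrow> l < (N + b - 1) div b"
proof -
  let ?y = "(N + b - 1) div b"
  have "?y * b + (N + b - 1) mod b = N + b - 1" by (rule div_mult_mod_eq)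
  moreover have "(N + b - 1) mod b < b" using assms by simp
  ultimately show 1: "N \<le> ?y * b" and 2: "?y * b < N + b" using assms by linarith+
  show "l * b < N \<longleftrightarrow> l < ?y"
  proof
    assume "l * b < N"
    then have "l * b < ?y * b" using 1 by linarith
    then show "l < ?y" by simp
  next
    assume "l < ?y"
    then have "(l + 1) * b \<le> ?y * b" by (intro mult_le_mono1) simp
    then show "l * b < N" using 2 by simp
  qed
qed

lemma sum_shift_mod:
  fixes F :: "nat \<Rightarrow> 'a :: comm_monoid_add"
  shows "(\<Sum>u<a. F ((u + s) mod a)) = (\<Sum>u<a. F u)"
proof (induction s)
  case (Suc s)
  have "(\<Sum>u<a. F ((u + Suc s) mod a)) = (\<Sum>u<a. F ((Suc u mod a + s) mod a))"
    by (simp add: mod_add_left_eq)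
  also have "\<dots> = (\<Sum>u<a. F ((u + s) mod a))" by (rule sum_Suc_mod[of "\<lambda>u. F ((u + s) mod a)"])
  finally show ?case using Suc by simp
qed (auto intro: sum.cong)

text \<open>Each block of \<open>a\<close> consecutive numbers meets every residue modulo
  \<open>a\<close> exactly once, whatever the shift.\<close>

lemma card_shifted_residues:
  assumes "i \<le> (a::nat)"
  shows "card {u \<in> {..<q * a}. (u + s) mod a < i} = q * i"
proof -
  let ?I = "\<lambda>u. if u < i then 1 else (0::nat)"
  have block: "(\<Sum>u\<in>{m * a..<m * a + a}. ?I ((u + s) mod a)) = i" for m
  proof -
    have "(\<Sum>u\<in>{m * a..<m * a + a}. ?I ((u + s) mod a)) = (\<Sum>u<a. ?I ((u + s) mod a))"
    proof -
      have "{m * a..<m * a + a} = {0 + m * a..<a + m * a}" by (simp add: add.commute)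
      then have "(\<Sum>u\<in>{m * a..<m * a + a}. ?I ((u + s) mod a)) = (\<Sum>u\<in>{0..<a}. ?I ((u + m * a + s) mod a))"
        by (simp only: sum.shift_bounds_nat_ivl)
      moreover have "(u + m * a + s) mod a = (u + s) mod a" for u
        by (metis add.assoc add.commute mod_mult_self1)
      ultimately show ?thesis by (simp only: lessThan_atLeast0)
    qed
    also have "\<dots> = (\<Sum>u<a. ?I u)" by (rule sum_shift_mod)
    also have "\<dots> = card {u \<in> {..<a}. u < i}" by (simp add: sum.If_cases Int_def)
    also have "{u \<in> {..<a}. u < i} = {..<i}" using assms by auto
    finally show ?thesis by simp
  qed
  have "card {u \<in> {..<q * a}. (u + s) mod a < i} = (\<Sum>u<q * a. ?I ((u + s) mod a))"
    by (simp add: sum.If_cases Int_def)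
  also have "\<dots> = (\<Sum>m<q. \<Sum>u\<in>{m * a..<m * a + a}. ?I ((u + s) mod a))"
    by (rule sum.nat_group[symmetric])
  also have "\<dots> = q * i" by (simp add: block)
  finally show ?thesis .
qed

lemma card_fibre_eq_diff:
  "card {t \<in> {..<k::nat}. F t < Suc v} = card {t \<in> {..<k}. F t < v} + card {t \<in> {..<k}. F t = (v::nat)}"
proof -
  have "{t \<in> {..<k}. F t < Suc v} = {t \<in> {..<k}. F t < v} \<union> {t \<in> {..<k}. F t = v}" by auto
  then show ?thesis by (simp add: card_Un_disjoint disjoint_iff)
qed

text \<open>\<open>a\<close> and \<open>b\<close> are the lengths of the arcs. \<open>Q\<close>
  exceeds the average number \<open>k / b\<close> of high ends per position by at least 3 and will
  bound the number of chords at any vertex. \<open>ba\<close> makes chords denser on the short arc,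
  and \<open>Qa\<close> keeps windows of length about \<open>Q\<close> at the two ends of the long
  arc apart.\<close>

locale chord_ends =
  fixes a b k Q :: nat
  assumes k_ge: "2 \<le> k" and b_ge: "2 \<le> b" and ba: "15 * b \<le> a"
    and kQ: "k + 3 * b \<le> b * Q" and Qa: "(3 * Q + 5) * (3 * Q + 5) \<le> a"
begin

text \<open>The first \<open>k mod a\<close> low ends are spread evenly over the long arc, the others run around it
  \<open>k div a\<close> times. Starting these rounds at \<open>Suc Q\<close> keeps the pairs \<open>(lo t, hi t)\<close> distinct and away
  from the forbidden pairs below. The high ends come in groups of two, the first of three if \<open>k\<close> is
  odd.\<close>

definition lo :: "nat \<Rightarrow> nat" where
  "lo t = (if t < k mod a then t * a div (k mod a) else (t - k mod a + Suc Q) mod a)"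

definition h :: nat where "h = k div 2"

definition e :: nat where "e = k mod 2"

text \<open>For odd \<open>k\<close> the truncated \<open>t - e\<close> sends both 0 and 1 to 0,
  which puts 0, 1 and 2 into group 0. The \<open>h\<close> groups are spread over the
  \<open>b\<close> positions by rounding down.\<close>

definition hi :: "nat \<Rightarrow> nat" where
  "hi t = (t - e) div 2 * b div h"

lemma k_eq: "k = 2 * h + e" and e_le: "e \<le> 1" by (auto simp: h_def e_def)

lemma a_pos: "0 < a" and b_pos: "0 < b" and h_pos: "0 < h" using k_ge b_ge ba k_eq e_le by auto

lemma pair_bounds: "t \<le> 2 * ((t - e) div 2) + 1 + e" "2 * ((t - e) div 2) \<le> t"
proof -
  have "2 * ((t - e) div 2) + (t - e) mod 2 = t - e" by simp
  moreover have "(t - e) mod 2 < 2" by simp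
  ultimately show "t \<le> 2 * ((t - e) div 2) + 1 + e" "2 * ((t - e) div 2) \<le> t" by linarith+
qed

lemma pair_less:
  assumes "t < k"
  shows "(t - e) div 2 < h"
proof -
  have "t - e < h * 2" using assms k_eq h_pos by simp
  then show ?thesis by (simp add: div_less_iff_less_mult)
qed

lemma hi_less:
  assumes "t < k"
  shows "hi t < b"
proof -
  have "(t - e) div 2 * b < h * b" using pair_less[OF assms] b_pos by simp
  then show ?thesis unfolding hi_def by (metis less_mult_imp_div_less mult.commute)
qed

text \<open>For \<open>i > 0\<close> the number \<open>y\<close> of groups placed below
  \<open>i\<close> is the ceiling of \<open>i * h / b\<close>, so \<open>2 * y + e\<close> ends lie
  there. Rounding costs less than \<open>2 * b\<close> and the additional end of the first group at
  most \<open>b\<close>.\<close>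

lemma card_hi:
  assumes "i \<le> b"
  shows "k * i \<le> b * card {t \<in> {..<k}. hi t < i}" "b * card {t \<in> {..<k}. hi t < i} < k * i + 3 * b"
proof -
  have "k * i \<le> b * card {t \<in> {..<k}. hi t < i} \<and> b * card {t \<in> {..<k}. hi t < i} < k * i + 3 * b"
  proof (cases "i = 0")
    case False
    define y where "y = (i * h + b - 1) div b"
    note y = ceiling_div_bounds[OF b_pos, where N = "i * h", folded y_def]
    have "0 < i * h" using False h_pos by simp
    then have "0 < y" using y(3)[of 0] by simp
    have "\<not> h * b < i * h" using assms by (simp add: mult.commute)
    then have "y \<le> h" using y(3)[of h] by simp
    have "hi t < i \<longleftrightarrow> t < 2 * y + e" for t
    proof -
      have "hi t < i \<longleftrightarrow> (t - e) div 2 * b < i * h"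
        unfolding hi_def by (rule div_less_iff_less_mult[OF h_pos])
      also have "\<dots> \<longleftrightarrow> (t - e) div 2 < y" by (rule y(3))
      also have "\<dots> \<longleftrightarrow> t - e < y * 2" by (rule div_less_iff_less_mult) simp
      also have "\<dots> \<longleftrightarrow> t < 2 * y + e" using \<open>0 < y\<close> by linarith
      finally show ?thesis .
    qed
    moreover have "2 * y + e \<le> k" using \<open>y \<le> h\<close> k_eq by linarith
    ultimately have "{t \<in> {..<k}. hi t < i} = {..<2 * y + e}" by (simp add: set_eq_iff) linarith
    then have c: "b * card {t \<in> {..<k}. hi t < i} = 2 * (y * b) + e * b" by (simp add: algebra_simps)
    have "k * i = 2 * (i * h) + e * i" by (subst k_eq) (simp add: algebra_simps)
    moreover have "e * i \<le> e * b" using assms by (rule mult_le_mono2)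
    moreover have "e * b \<le> 1 * b" using e_le by (rule mult_le_mono1)
    ultimately show ?thesis unfolding c using y(1,2) by linarith
  qed (use b_ge in simp)
  then show "k * i \<le> b * card {t \<in> {..<k}. hi t < i}" "b * card {t \<in> {..<k}. hi t < i} < k * i + 3 * b" by auto
qed

text \<open>Groups at the same position have indices that differ by less than \<open>h / b\<close>.
  Each group has two members, apart from the extra one in the first, and \<open>kQ\<close> turns
  this into a bound by \<open>Q\<close>.\<close>

lemma hi_eq_close:
  assumes "t \<le> t'" "hi t = hi t'"
  shows "t' < t + Q"
proof -
  define l l' where "l = (t - e) div 2" and "l' = (t' - e) div 2"
  have "hi t * h \<le> l * b" unfolding hi_def l_def by (rule div_times_less_eq_dividend)
  moreover have "l' * b < hi t' * h + h" unfolding hi_def l'_def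
    using h_pos by (metis add.commute dividend_less_div_times)
  ultimately have 1: "l' * b < l * b + h" using assms by simp
  have "l \<le> l'" using assms(1) unfolding l_def l'_def by (intro div_le_mono) simp
  then obtain m where m: "l' = l + m" using le_Suc_ex by blast
  have "t' \<le> t + 2 * m + 2" using pair_bounds(1)[of t'] pair_bounds(2)[of t] e_le m
    unfolding l_def[symmetric] l'_def[symmetric] by linarith
  then have "b * t' \<le> b * (t + 2 * m + 2)" by (rule mult_le_mono2)
  also have "\<dots> = b * t + 2 * (m * b) + 2 * b" by (simp add: algebra_simps)
  also have "\<dots> < b * t + 2 * h + 2 * b" using 1 m by (simp add: algebra_simps)
  also have "\<dots> \<le> b * t + b * Q" using kQ k_eq by linarith
  finally have "b * t' < b * (t + Q)" by (simp add: algebra_simps)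
  then show ?thesis by simp
qed

lemma hi_0: "hi 0 = 0" by (simp add: hi_def)

lemma last_pair: "(k - 1 - e) div 2 = h - 1"
proof -
  have "k - 1 - e = 2 * (h - 1) + 1" using k_eq h_pos by linarith
  then show ?thesis by simp
qed

text \<open>With at least \<open>b\<close> groups their spacing \<open>b / h\<close> is at most 1,
  so the last group reaches the last position. This decides which rigidity argument applies.\<close>

lemma hi_last:
  assumes "b \<le> h"
  shows "hi (k - 1) = b - 1"
proof -
  have "(h - 1) * b div h = b - 1"
  proof (rule div_nat_eqI)
    have "h * (b - 1) = h * b - h" "(h - 1) * b = h * b - b" by (simp_all add: diff_mult_distrib diff_mult_distrib2)
    then show "h * (b - 1) \<le> (h - 1) * b" using assms by linarith
    have "(h - 1) * b < h * b" using h_pos b_ge by simp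
    then show "(h - 1) * b < h * Suc (b - 1)" using b_ge by simp
  qed
  then show ?thesis unfolding hi_def last_pair .
qed

lemma hi_not_last:
  assumes "h < b" "t < k"
  shows "hi t \<noteq> b - 1"
proof -
  have "(t - e) div 2 \<le> h - 1" using pair_less[OF assms(2)] by linarith
  then have "(t - e) div 2 * b \<le> (h - 1) * b" by (rule mult_le_mono1)
  also have "\<dots> = h * b - b" by (simp add: diff_mult_distrib)
  also have "\<dots> < h * b - h"
  proof -
    have "b \<le> h * b" using h_pos by simp
    then show ?thesis using assms(1) by linarith
  qed
  also have "\<dots> = (b - 1) * h" by (simp only: diff_mult_distrib mult_1) (simp only: mult.commute)
  finally have "hi t < b - 1" unfolding hi_def by (metis less_mult_imp_div_less)
  then show ?thesis by simp
qed

text \<open>The distance from the last occupied high position to the end of the short arc is at most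
  \<open>b / h + 1\<close>. The spacing of the low ends is about \<open>a / k\<close>, which is
  larger because \<open>a\<close> is at least \<open>15 * b\<close>.\<close>

lemma last_hi_gap:
  assumes "h < b"
  shows "k * (b - hi (k - 1) + 1) \<le> a"
proof -
  let ?d = "b - hi (k - 1)"
  have "(h - 1) * b < hi (k - 1) * h + h" unfolding hi_def last_pair
    using h_pos by (metis add.commute dividend_less_div_times)
  moreover have "h * ?d = h * b - hi (k - 1) * h" by (simp add: diff_mult_distrib2 mult.commute)
  moreover have "(h - 1) * b = h * b - b" by (simp add: diff_mult_distrib)
  moreover have "b \<le> h * b" using h_pos by simp
  ultimately have hd: "h * ?d \<le> b + h" by linarith
  have k3: "k \<le> 3 * h" using k_eq e_le h_pos by linarith
  have "h * (k * (?d + 1)) = k * (h * ?d) + k * h" by (simp add: algebra_simps)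
  also have "\<dots> \<le> k * (b + h) + k * h" using hd by simp
  also have "\<dots> = k * b + h * (2 * k)" by (simp add: algebra_simps)
  also have "\<dots> \<le> 3 * h * b + h * (2 * k)" using k3 by simp
  also have "\<dots> = h * (3 * b + 2 * k)" by (simp add: algebra_simps)
  finally have "k * (?d + 1) \<le> 3 * b + 2 * k" using h_pos by simp
  also have "\<dots> \<le> a" using assms ba k_eq e_le b_ge by linarith
  finally show ?thesis .
qed

text \<open>An occupied position receives an entire group, hence its vertex will have degree at
  least 4.\<close>

lemma card_hi_fibre_ge_2:
  assumes "t < k"
  shows "2 \<le> card {t' \<in> {..<k}. hi t' = hi t}"
proof -
  define l where "l = (t - e) div 2"
  have "l < h" using pair_less[OF assms] by (simp add: l_def)
  then have "Suc (2 * l + e) < k" using k_eq by linarith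
  moreover have "hi (2 * l + e) = hi t" "hi (Suc (2 * l + e)) = hi t" by (simp_all add: hi_def l_def[symmetric])
  ultimately have "{2 * l + e, Suc (2 * l + e)} \<subseteq> {t' \<in> {..<k}. hi t' = hi t}" by simp
  then have "card {2 * l + e, Suc (2 * l + e)} \<le> card {t' \<in> {..<k}. hi t' = hi t}" by (intro card_mono) auto
  then show ?thesis by simp
qed

text \<open>The prefix counts at \<open>v\<close> and \<open>v + 1\<close> exceed their ideal values
  by amounts in the interval from 0 to 3, excluding 3, so their difference is within 3 of
  \<open>k / b\<close>.\<close>

lemma card_hi_fibre:
  assumes "v < b"
  shows "card {t \<in> {..<k}. hi t = v} \<le> Q" "k < b * (card {t \<in> {..<k}. hi t = v} + 3)"
proof -
  let ?c = "card {t \<in> {..<k}. hi t = v}"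
  have e: "b * card {t \<in> {..<k}. hi t < Suc v} = b * card {t \<in> {..<k}. hi t < v} + b * ?c"
    unfolding card_fibre_eq_diff by (rule add_mult_distrib2)
  have "k * Suc v = k * v + k" by simp
  then have "b * ?c < k + 3 * b" "k < b * ?c + 3 * b"
    using card_hi[of v] card_hi[of "Suc v"] assms e by linarith+
  then have "b * ?c < b * Q" "k < b * ?c + 3 * b" using kQ by linarith+
  then show "?c \<le> Q" "k < b * (?c + 3)" by (auto simp: algebra_simps)
qed

lemma lo_less: "lo t < a"
proof (cases "t < k mod a")
  case True
  then have "t * a < a * (k mod a)" using a_pos by (simp add: mult.commute)
  then show ?thesis using True by (simp add: lo_def less_mult_imp_div_less)
qed (use a_pos in \<open>simp add: lo_def\<close>)

text \<open>Below \<open>i\<close>, the evenly spread part has the ceiling of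
  \<open>i * (k mod a) / a\<close> ends, and each of the \<open>k div a\<close> rounds has exactly
  \<open>i\<close>. Only the first part involves rounding.\<close>

lemma card_lo:
  assumes "i \<le> a"
  shows "k * i \<le> a * card {t \<in> {..<k}. lo t < i}" "a * card {t \<in> {..<k}. lo t < i} < k * i + a"
proof -
  let ?q = "k div a" and ?r = "k mod a"
  have k: "k = ?q * a + ?r" by simp
  define y where "y = (i * ?r + a - 1) div a"
  note y = ceiling_div_bounds[OF a_pos, where N = "i * ?r", folded y_def]
  have "\<not> ?r * a < i * ?r" using assms by (simp add: mult.commute)
  then have "y \<le> ?r" using y(3)[of ?r] by simp
  have part: "{t \<in> {..<k}. t < ?r \<and> lo t < i} = {..<y}"
  proof -
    have "lo t < i \<longleftrightarrow> t < y" if "t < ?r" for t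
      using y(3)[of t] that by (simp add: lo_def div_less_iff_less_mult)
    moreover have "t < k" if "t < y" for t using that \<open>y \<le> ?r\<close> mod_less_eq_dividend[of k a] by linarith
    ultimately show ?thesis using \<open>y \<le> ?r\<close> by auto
  qed
  have full: "card {t \<in> {..<k}. ?r \<le> t \<and> lo t < i} = ?q * i"
  proof -
    have "{t \<in> {..<k}. ?r \<le> t \<and> lo t < i} = (\<lambda>u. u + ?r) ` {u \<in> {..<?q * a}. (u + Suc Q) mod a < i}"
    proof (intro equalityI subsetI)
      fix t assume "t \<in> {t \<in> {..<k}. ?r \<le> t \<and> lo t < i}"
      then have t: "t < k" "?r \<le> t" "lo t < i" by auto
      show "t \<in> (\<lambda>u. u + ?r) ` {u \<in> {..<?q * a}. (u + Suc Q) mod a < i}"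
      proof (rule image_eqI[of _ _ "t - ?r"])
        show "t = t - ?r + ?r" using t by simp
        have "t - ?r < ?q * a" using t k by linarith
        then show "t - ?r \<in> {u \<in> {..<?q * a}. (u + Suc Q) mod a < i}" using t by (simp add: lo_def)
      qed
    next
      fix t assume "t \<in> (\<lambda>u. u + ?r) ` {u \<in> {..<?q * a}. (u + Suc Q) mod a < i}"
      then obtain u where u: "t = u + ?r" "u < ?q * a" "(u + Suc Q) mod a < i" by auto
      then have "t < k" using k by linarith
      then show "t \<in> {t \<in> {..<k}. ?r \<le> t \<and> lo t < i}" using u by (simp add: lo_def)
    qed
    then show ?thesis using card_shifted_residues[OF assms, of ?q "Suc Q"]
      by (simp add: card_image)
  qed
  have split: "{t \<in> {..<k}. lo t < i} = {t \<in> {..<k}. t < ?r \<and> lo t < i} \<union> {t \<in> {..<k}. ?r \<le> t \<and> lo t < i}" by auto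
  have "card {t \<in> {..<k}. lo t < i} =
      card {t \<in> {..<k}. t < ?r \<and> lo t < i} + card {t \<in> {..<k}. ?r \<le> t \<and> lo t < i}"
    unfolding split by (rule card_Un_disjoint) auto
  then have "card {t \<in> {..<k}. lo t < i} = y + ?q * i" by (simp only: part full card_lessThan)
  then have "a * card {t \<in> {..<k}. lo t < i} = y * a + ?q * a * i"
    by (simp only: add_mult_distrib2 mult_ac)
  moreover have "k * i = (?q * a + ?r) * i" by (simp only: div_mult_mod_eq)
  then have "k * i = i * ?r + ?q * a * i" by (simp only: add_mult_distrib add_mult_distrib2 mult_ac add.commute)
  ultimately show "k * i \<le> a * card {t \<in> {..<k}. lo t < i}" "a * card {t \<in> {..<k}. lo t < i} < k * i + a"
    using y(1,2) by linarith+
qed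

lemma card_lo_fibre:
  assumes "v < a"
  shows "card {t \<in> {..<k}. lo t = v} \<le> k div a + 1"
proof -
  let ?c = "card {t \<in> {..<k}. lo t = v}"
  have e: "a * card {t \<in> {..<k}. lo t < Suc v} = a * card {t \<in> {..<k}. lo t < v} + a * ?c"
    unfolding card_fibre_eq_diff by (rule add_mult_distrib2)
  have "k * Suc v = k * v + k" by simp
  then have "a * ?c < k + a"
    using card_lo[of v] card_lo[of "Suc v"] assms e by linarith
  moreover have "k = k div a * a + k mod a" "k mod a < a" using a_pos by auto
  moreover have "(k div a + 2) * a = k div a * a + 2 * a" by (rule add_mult_distrib)
  ultimately have "a * ?c < (k div a + 2) * a" by linarith
  then have "?c < k div a + 2" by (metis mult.commute mult_less_cancel2)
  then show ?thesis by simp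
qed

end

section \<open>Admissible pairings\<close>

lemma card_Collect_permuted:
  assumes "p permutes A"
  shows "card {t \<in> A. P (p t)} = card {t \<in> A. P t}"
proof -
  have "p ` {t \<in> A. P (p t)} = {t \<in> A. P t}"
  proof (intro equalityI subsetI)
    fix t assume "t \<in> {t \<in> A. P t}"
    then show "t \<in> p ` {t \<in> A. P (p t)}"
      using permutes_in_image[OF permutes_inv[OF assms], of t] permutes_inverses[OF assms]
      by (intro image_eqI[of _ _ "inv p t"]) auto
  qed (use permutes_in_image[OF assms] in auto)
  then show ?thesis using card_image[OF inj_on_subset[OF permutes_inj[OF assms]], of "{t \<in> A. P (p t)}"] by simp
qed

context chord_ends
begin

lemma Q_ge: "4 \<le> Q"
proof (rule ccontr)
  assume "\<not> 4 \<le> Q"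
  then have "b * Q \<le> b * 3" by (intro mult_le_mono2) simp
  then show False using kQ k_ge by linarith
qed

lemma a_big: "Q * (2 * Q + 2) < a" "Suc Q * Suc Q < a" "3 * Q + 5 < a"
proof -
  define z where "z = Q * Q"
  have "(3 * Q + 5) * (3 * Q + 5) = 9 * z + 30 * Q + 25" by (simp add: algebra_simps z_def)
  then have "9 * z + 30 * Q + 25 \<le> a" using Qa by simp
  then have "2 * z + 2 * Q < a" "z + 2 * Q + 1 < a" "3 * Q + 5 < a" by linarith+
  moreover have "Q * (2 * Q + 2) = 2 * z + 2 * Q" "Suc Q * Suc Q = z + 2 * Q + 1"
    by (simp_all add: algebra_simps z_def)
  ultimately show "Q * (2 * Q + 2) < a" "Suc Q * Suc Q < a" "3 * Q + 5 < a" by simp_all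
qed

lemma div_a_less: "k div a < Q"
proof -
  have "b * Q \<le> a * Q" using ba by (intro mult_le_mono1) simp
  then have "k < a * Q" using kQ b_ge by linarith
  then have "k < Q * a" by (simp only: mult.commute)
  then show ?thesis by (rule less_mult_imp_div_less)
qed

lemma lo_full_start:
  assumes "k mod a \<le> t" "t < k mod a + Q"
  shows "lo t = t - k mod a + Suc Q"
proof -
  have "t - k mod a + Suc Q < a" using assms a_big(3) by linarith
  then show ?thesis using assms by (simp add: lo_def)
qed

text \<open>Equal high ends force the indices to be closer than \<open>Q\<close>. Within the spread
  part \<open>lo\<close> is strictly increasing, and within the rounds a shift by less than
  \<open>a\<close> changes the residue. In the mixed case \<open>t'\<close> is at the start of a
  round, so its value is small, while \<open>t\<close> is near the end of the spread part, so its
  value is large.\<close>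

lemma lo_neq:
  assumes t: "t < t'" "t' < k" "hi t = hi t'"
  shows "lo t \<noteq> lo t'"
proof
  assume eq: "lo t = lo t'"
  define r where "r = k mod a"
  have close: "t' < t + Q" using hi_eq_close t by simp
  have ra: "r < a" using a_pos by (simp add: r_def)
  consider "t' < r" | "t < r" "r \<le> t'" | "r \<le> t" using t by linarith
  then show False
  proof cases
    case 1
    then have "t * a div r = t' * a div r" using eq t by (simp add: lo_def r_def)
    moreover have "(t + 1) * a \<le> t' * a" using t by (intro mult_le_mono1) simp
    then have "t * a + r \<le> t' * a" using ra by simp
    then have "(t * a + r) div r \<le> t' * a div r" by (rule div_le_mono)
    moreover have "(t * a + r) div r = t * a div r + 1" using 1 by simp
    ultimately show False by simp
  next
    case 2
    then have "t * a div r = t' - r + Suc Q"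
      using eq lo_full_start[of t'] close by (simp add: lo_def r_def)
    then have w: "t * a div r \<le> 2 * Q" "t * a div r \<noteq> 0" using close 2 by linarith+
    then have "t \<noteq> 0" by (intro notI) simp
    \<comment> \<open>As \<open>t > 0\<close>, this yields \<open>r \<le> t * Q\<close>, hence
      \<open>t * a / r\<close> is at least \<open>a / Q\<close>, which exceeds
      \<open>2 * Q + 1\<close>.\<close>
    have "r \<le> t + (Q - 1)" using close 2 by linarith
    also have "\<dots> \<le> t + t * (Q - 1)" using \<open>t \<noteq> 0\<close> by simp
    also have "\<dots> = t * Q" using Q_ge by (cases Q) auto
    finally have r: "r \<le> t * Q" .
    have "t * a div r < 2 * Q + 1" using w by simp
    then have "t * a < (2 * Q + 1) * r" using 2 by (simp only: div_less_iff_less_mult)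
    also have "\<dots> \<le> (2 * Q + 1) * (t * Q)" using r by (rule mult_le_mono2)
    also have "\<dots> = t * (Q * (2 * Q + 1))" by (simp only: mult_ac)
    finally have "a < Q * (2 * Q + 1)" by simp
    then show False using a_big(1) by (simp add: algebra_simps)
  next
    case 3
    define u v where "u = t - r + Suc Q" and "v = t' - r + Suc Q"
    have "u mod a = v mod a" using eq 3 t by (simp add: lo_def r_def[symmetric] u_def v_def)
    then have "a dvd v - u" using mod_eq_dvd_iff_nat[of u v a] t 3 by (simp add: u_def v_def)
    moreover have "0 < v - u" "v - u < a" using t 3 close a_big(3) by (auto simp: u_def v_def)
    ultimately show False using nat_dvd_not_less by blast
  qed
qed

lemma inj_base: "inj_on (\<lambda>t. (lo t, hi t)) {..<k}"
proof (rule inj_onI)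
  fix t t' assume "t \<in> {..<k}" "t' \<in> {..<k}" "(lo t, hi t) = (lo t', hi t')"
  then show "t = t'" using lo_neq[of t t'] lo_neq[of t' t] by (cases t t' rule: linorder_cases) auto
qed

lemma lo_partial_neq_last:
  assumes "t < k mod a"
  shows "lo t \<noteq> a - 1"
proof -
  define r where "r = k mod a"
  have t: "t \<le> r - 1" "0 < r" "r < a" using assms a_pos by (auto simp: r_def)
  have "t * a \<le> (r - 1) * a" using t(1) by (rule mult_le_mono1)
  also have "\<dots> = r * a - a" by (simp only: diff_mult_distrib mult_1)
  also have "\<dots> < r * a - r"
  proof -
    have "a \<le> r * a" using t by simp
    then show ?thesis using t by linarith
  qed
  also have "\<dots> = (a - 1) * r" by (simp only: diff_mult_distrib mult_1) (simp only: mult.commute)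
  finally have "t * a div r < a - 1" by (rule less_mult_imp_div_less)
  then show ?thesis using assms by (simp add: lo_def r_def)
qed

lemma hi_eq_0:
  assumes "hi t = 0"
  shows "t < Q"
  using hi_eq_close[of 0 t] assms hi_0 by simp

lemma base_avoid_first:
  assumes "t < k" "hi t = 0"
  shows "lo t \<noteq> a - 1"
proof (cases "t < k mod a")
  case True
  then show ?thesis by (rule lo_partial_neq_last)
next
  case False
  then have "lo t = t - k mod a + Suc Q" using hi_eq_0[OF assms(2)] by (intro lo_full_start) auto
  then show ?thesis using hi_eq_0[OF assms(2)] a_big(3) by linarith
qed

lemma h_ge:
  assumes "a \<le> k"
  shows "b \<le> h"
  using assms ba k_eq e_le b_ge by linarith

text \<open>The rounds make \<open>(k div a) * a\<close> steps starting at \<open>Suc Q\<close>, so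
  the last one ends at \<open>Q\<close>; counting backwards from \<open>k - 1\<close> gives the
  formula. The chords at the last high position thus have low ends between 1 and
  \<open>Q\<close>.\<close>

lemma lo_tail:
  assumes "a \<le> k" "t < k" "hi t = b - 1"
  shows "k \<le> t + Q" "lo t = Suc Q - (k - t)"
proof -
  have "hi t = hi (k - 1)" using hi_last[OF h_ge[OF assms(1)]] assms(3) by simp
  then have "k - 1 < t + Q" using hi_eq_close[of t "k - 1"] assms(2) by simp
  then show 1: "k \<le> t + Q" by simp
  define q r where "q = k div a" and "r = k mod a"
  have k: "k = q * a + r" by (simp add: q_def r_def)
  have "1 \<le> q" using assms(1) a_pos by (simp add: q_def Suc_le_eq div_greater_zero_iff)
  then have "1 * a \<le> q * a" by (rule mult_le_mono1)
  then have rt: "r \<le> t" using 1 k a_big(3) by linarith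
  have "t - r + Suc Q = (Suc Q - (k - t)) + q * a" using k rt 1 assms(2) by linarith
  then have "(t - r + Suc Q) mod a = (Suc Q - (k - t)) mod a" by simp
  also have "\<dots> = Suc Q - (k - t)" using a_big(3) by simp
  finally show "lo t = Suc Q - (k - t)" using rt by (simp add: lo_def r_def)
qed

lemma base_avoid_last:
  assumes "t < k" "hi t = b - 1"
  shows "lo t \<noteq> 0"
proof (cases "a \<le> k")
  case True
  then show ?thesis using lo_tail[OF True assms] by simp
next
  case False
  then have "t * a div k \<noteq> 0" if "t \<noteq> 0"
  proof -
    have "1 * a \<le> t * a" using that by (intro mult_le_mono1) simp
    then have "k \<le> t * a" using False by linarith
    then show ?thesis using k_ge by (simp add: div_eq_0_iff)
  qed
  moreover have "t \<noteq> 0" using assms(2) hi_0 b_ge by (intro notI) simp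
  ultimately show ?thesis using False assms(1) by (simp add: lo_def)
qed

lemma base_avoid_corner:
  assumes "a \<le> k" "t < k" "hi t = b - 1"
  shows "lo t \<noteq> a - 1"
  using lo_tail[OF assms] a_big(3) by simp

text \<open>\<open>a - Suc Q\<close> is the mirror image of \<open>Q\<close> in the long arc. Here
  \<open>t < Q\<close>, so in the rounds \<open>lo t\<close> is at most \<open>2 * Q\<close>. In the
  spread part, reaching \<open>a - Suc Q\<close> means \<open>a * (r - t) \<le> Suc Q * r\<close>,
  and \<open>r \<le> (t + 1) * (r - t)\<close> then bounds \<open>a\<close> by
  \<open>Suc Q * Suc Q\<close>.\<close>

lemma base_avoid_mirror:
  assumes "a \<le> k" "t < k" "hi t = 0"
  shows "lo t \<noteq> a - Suc Q"
proof (cases "t < k mod a")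
  case True
  define r where "r = k mod a"
  have tr: "t < r" using True by (simp add: r_def)
  show ?thesis
  proof
    assume "lo t = a - Suc Q"
    then have "t * a div r = a - Suc Q" using True by (simp add: lo_def r_def)
    then have "(a - Suc Q) * r \<le> t * a" by (metis div_times_less_eq_dividend)
    then have 1: "a * r \<le> t * a + Suc Q * r" unfolding diff_mult_distrib by linarith
    obtain y where y: "r = t + y" "y \<noteq> 0" using tr by (metis less_imp_add_positive neq0_conv)
    have "t \<le> t * y" using y by simp
    then have r: "r \<le> (t + 1) * y" using y by simp
    have "a * y \<le> Suc Q * r" using 1 y by (simp add: algebra_simps)
    also have "\<dots> \<le> Suc Q * ((t + 1) * y)" using r by (rule mult_le_mono2)
    also have "\<dots> = Suc Q * (t + 1) * y" by (simp only: mult_ac)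
    finally have "a \<le> Suc Q * (t + 1)" using y(2) by (metis mult_le_cancel2 neq0_conv)
    also have "\<dots> \<le> Suc Q * Suc Q" using hi_eq_0[OF assms(3)] by (intro mult_le_mono2) simp
    finally show False using a_big(2) by simp
  qed
next
  case False
  then have "lo t = t - k mod a + Suc Q" using hi_eq_0[OF assms(3)] by (intro lo_full_start) auto
  then show ?thesis using hi_eq_0[OF assms(3)] a_big(3) by linarith
qed

text \<open>The first two pairs would be cycle edges. The other two are excluded, and the last chord is
  kept, in order to destroy the reversals of the two arcs.\<close>

definition forbidden :: "(nat \<times> nat) set" where
  "forbidden = {(a - 1, 0), (0, b - 1)} \<union> (if a \<le> k then {(a - 1, b - 1), (a - Suc Q, 0)} else {})"

definition good :: "(nat \<Rightarrow> nat) set" where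
  "good = {p. p permutes {..<k} \<and> p (k - 1) = k - 1 \<and>
     inj_on (\<lambda>t. (lo (p t), hi t)) {..<k} \<and> (\<forall>t<k. (lo (p t), hi t) \<notin> forbidden)}"

lemma card_lo_fibre_le: "card {t \<in> {..<k}. lo t = v} \<le> Q"
proof (cases "v < a")
  case True
  then show ?thesis using card_lo_fibre[OF True] div_a_less by simp
next
  case False
  then have "{t \<in> {..<k}. lo t = v} = {}" using lo_less by auto
  then show ?thesis by (simp only: card.empty)
qed

lemma card_hi_fibre_le: "card {t \<in> {..<k}. hi t = v} \<le> Q"
proof (cases "v < b")
  case True
  then show ?thesis by (rule card_hi_fibre)
next
  case False
  then have "{t \<in> {..<k}. hi t = v} = {}" using hi_less by auto
  then show ?thesis by (simp only: card.empty)
qed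

lemma card_forbidden: "finite forbidden" "card forbidden \<le> 4"
proof -
  have "forbidden \<subseteq> set [(a - 1, 0), (0, b - 1), (a - 1, b - 1), (a - Suc Q, 0)]"
    by (auto simp: forbidden_def)
  then have "finite forbidden \<and> card forbidden \<le> card (set [(a - 1, 0), (0, b - 1), (a - 1, b - 1), (a - Suc Q, 0)])"
    by (meson List.finite_set card_mono finite_subset)
  moreover have "card (set [(a - 1, 0), (0, b - 1), (a - 1, b - 1), (a - Suc Q, 0)]) \<le> 4"
    using card_length[of "[(a - 1, 0), (0, b - 1), (a - 1, b - 1), (a - Suc Q, 0)]"] by simp
  ultimately show "finite forbidden" "card forbidden \<le> 4" by auto
qed

text \<open>Each end lies in at most \<open>Q\<close> chords of the base pairing and at most 4
  forbidden pairs, which gives the conflict bound \<open>Q + 4\<close>.\<close>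

lemma card_good: "fact k \<le> ((Q + 4) * (Q + 4) + 2) ^ k * card good"
  unfolding good_def
proof (rule many_simple_pairings)
  let ?P = "(\<lambda>t. (lo t, hi t)) ` {..<k} \<union> forbidden"
  show "inj_on (\<lambda>t. (lo t, hi t)) {..<k}" by (rule inj_base)
  show "finite forbidden" by (rule card_forbidden)
  show "k - 1 < k" using k_ge by simp
  show "(lo t, hi t) \<notin> forbidden" if "t < k" for t
    using base_avoid_first[OF that] base_avoid_last[OF that] base_avoid_corner[OF _ that]
      base_avoid_mirror[OF _ that] by (auto simp: forbidden_def)
  show "card {y. (x, y) \<in> ?P} \<le> Q + 4" for x
  proof -
    have "{y. (x, y) \<in> ?P} \<subseteq> hi ` {t \<in> {..<k}. lo t = x} \<union> snd ` forbidden" by force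
    then have "card {y. (x, y) \<in> ?P} \<le> card (hi ` {t \<in> {..<k}. lo t = x} \<union> snd ` forbidden)"
      using card_forbidden by (intro card_mono) auto
    also have "\<dots> \<le> card (hi ` {t \<in> {..<k}. lo t = x}) + card (snd ` forbidden)" by (rule card_Un_le)
    also have "\<dots> \<le> card {t \<in> {..<k}. lo t = x} + card forbidden"
      using card_forbidden by (intro add_mono card_image_le) auto
    also have "\<dots> \<le> Q + 4" using card_lo_fibre_le card_forbidden by (intro add_mono) auto
    finally show ?thesis .
  qed
  show "card {x. (x, y) \<in> ?P} \<le> Q + 4" for y
  proof -
    have "{x. (x, y) \<in> ?P} \<subseteq> lo ` {t \<in> {..<k}. hi t = y} \<union> fst ` forbidden" by force
    then have "card {x. (x, y) \<in> ?P} \<le> card (lo ` {t \<in> {..<k}. hi t = y} \<union> fst ` forbidden)"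
      using card_forbidden by (intro card_mono) auto
    also have "\<dots> \<le> card (lo ` {t \<in> {..<k}. hi t = y}) + card (fst ` forbidden)" by (rule card_Un_le)
    also have "\<dots> \<le> card {t \<in> {..<k}. hi t = y} + card forbidden"
      using card_forbidden by (intro add_mono card_image_le) auto
    also have "\<dots> \<le> Q + 4" using card_hi_fibre_le card_forbidden by (intro add_mono) auto
    finally show ?thesis .
  qed
qed

lemma cycle_with_chords_good:
  assumes "p \<in> good"
  shows "cycle_with_chords (a + b) a k (\<lambda>t. lo (p t)) (\<lambda>t. a + hi t)"
proof
  have p: "inj_on (\<lambda>t. (lo (p t), hi t)) {..<k}" "\<And>t. t < k \<Longrightarrow> (lo (p t), hi t) \<notin> forbidden"
    using assms by (auto simp: good_def)
  show "2 \<le> a" "a + 2 \<le> a + b" using ba b_ge by auto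
  show "inj_on (\<lambda>t. (lo (p t), a + hi t)) {..<k}" using p(1) by (auto simp: inj_on_def)
  fix t assume t: "t < k"
  show "lo (p t) < a" "a \<le> a + hi t" "a + hi t < a + b" using lo_less hi_less[OF t] by auto
  show "(lo (p t), a + hi t) \<noteq> (a - 1, a)" "(lo (p t), a + hi t) \<noteq> (0, a + b - 1)"
    using p(2)[OF t] b_ge by (auto simp: forbidden_def)
qed

end

section \<open>The graph of an admissible pairing\<close>

context chord_ends
begin

definition good_graph :: "(nat \<Rightarrow> nat) \<Rightarrow> nat graph" where
  "good_graph p = ({..<a + b}, cycle_with_chords.E (a + b) k (\<lambda>t. lo (p t)) (\<lambda>t. a + hi t))"

context
  fixes p assumes p: "p \<in> good"
begin

interpretation C: cycle_with_chords "a + b" a k "\<lambda>t. lo (p t)" "\<lambda>t. a + hi t"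
  by (rule cycle_with_chords_good[OF p])

lemma perm: "p permutes {..<k}" and p_last: "p (k - 1) = k - 1"
  and p_avoid: "\<And>t. t < k \<Longrightarrow> (lo (p t), hi t) \<notin> forbidden"
  using p by (auto simp: good_def)

lemma deg_lo: "v < a \<Longrightarrow> C.deg v = 2 + card {t \<in> {..<k}. lo t = v}"
  by (simp only: C.deg_low card_Collect_permuted[OF perm, of "\<lambda>t. lo t = v"])

lemma deg_hi: "v < b \<Longrightarrow> C.deg (a + v) = 2 + card {t \<in> {..<k}. hi t = v}"
  using C.deg_high[of "a + v"] by simp

lemma good_graph_simple: "simple_graph (good_graph p)"
  unfolding good_graph_def by (rule C.simple_E)

lemma card_good_graph: "card (edges (good_graph p)) = a + b + k"
  by (simp add: good_graph_def C.card_E)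

lemma deg_good_graph:
  assumes "v < a + b"
  shows "card {u. u < a + b \<and> {u, v} \<in> edges (good_graph p)} \<le> Q + 2"
proof -
  have "C.deg v \<le> Q + 2"
  proof (cases "v < a")
    case True
    then show ?thesis using card_lo_fibre_le[of v] by (simp only: deg_lo)
  next
    case False
    then obtain w where "v = a + w" by (metis le_iff_add not_less)
    then show ?thesis using card_hi_fibre_le[of w] deg_hi[of w] assms by simp
  qed
  then show ?thesis by (simp add: C.deg_def C.nbrs_def good_graph_def)
qed

lemma good_graph_cycle_edge: "i < a + b \<Longrightarrow> {i, Suc i mod (a + b)} \<in> edges (good_graph p)"
  by (auto simp: good_graph_def C.E_def)

lemma good_graph_chord: "t < k \<Longrightarrow> {lo (p t), a + hi t} \<in> edges (good_graph p)"
  by (auto simp: good_graph_def C.E_def)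

lemma good_graph_sparse:
  assumes "S \<subseteq> {..<a + b}" "S \<noteq> {}" "S \<noteq> {..<a + b}"
  shows "(a + b) * card {e \<in> edges (good_graph p). e \<subseteq> S} < (a + b + k) * card S"
  unfolding good_graph_def snd_conv
proof (rule C.sparse[OF _ _ _ _ assms])
  fix i assume i: "i \<le> a"
  have c: "card {t \<in> {..<k}. lo (p t) < i} = card {t \<in> {..<k}. lo t < i}"
    by (rule card_Collect_permuted[OF perm])
  show "k * i \<le> a * card {t \<in> {..<k}. lo (p t) < i}" unfolding c by (rule card_lo(1)[OF i])
  show "a * card {t \<in> {..<k}. lo (p t) < i} < k * i + (a + b)" unfolding c using card_lo(2)[OF i] by linarith
next
  fix i assume "i \<le> a + b - a"
  then have i: "i \<le> b" by simp
  have c: "(a + b - a) * card {t \<in> {..<k}. a + hi t < a + i} = b * card {t \<in> {..<k}. hi t < i}" by simp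
  show "k * i \<le> (a + b - a) * card {t \<in> {..<k}. a + hi t < a + i}"
    unfolding c by (rule card_hi(1)[OF i])
  show "(a + b - a) * card {t \<in> {..<k}. a + hi t < a + i} < k * i + (a + b)"
    unfolding c using card_hi(2)[OF i] ba by linarith
qed

text \<open>With \<open>q = k div a\<close>, vertices of the long arc carry at most
  \<open>q + 1\<close> chords. Those of the short arc carry more than \<open>15 * q - 3\<close>,
  which is larger since \<open>q\<close> is at least 1. The fixed chord \<open>k - 1\<close>
  supplies the edge between \<open>Q\<close> and the last vertex, and the corner and mirror edges
  are absent because their pairs are forbidden.\<close>

lemma good_graph_rigid_dense:
  assumes ak: "a \<le> k"
    and \<psi>: "bij_betw \<psi> {..<a + b} {..<a + b}"
      "\<And>u v. u < a + b \<Longrightarrow> v < a + b \<Longrightarrow> {\<psi> u, \<psi> v} \<in> C.E \<longleftrightarrow> {u, v} \<in> C.E"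
  shows "\<forall>v<a + b. \<psi> v = v"
proof (rule C.rigid_if_degrees_separate[OF \<psi>, where D = "k div a + 3" and x = Q])
  show "C.deg v \<le> k div a + 3" if "v < a" for v using card_lo_fibre[OF that] deg_lo[OF that] by simp
  show "k div a + 3 < C.deg v" if v: "a \<le> v" "v < a + b" for v
  proof -
    obtain w where w': "v = a + w" using \<open>a \<le> v\<close> le_Suc_ex by blast
    then have w: "v = a + w" "w < b" using \<open>v < a + b\<close> by auto
    define c q where "c = card {t \<in> {..<k}. hi t = w}" and "q = k div a"
    have "15 * q * b = q * (15 * b)" by simp
    also have "\<dots> \<le> q * a" using ba by (rule mult_le_mono2)
    also have "\<dots> \<le> k" by (simp add: q_def)
    also have "k < b * (c + 3)" unfolding c_def by (rule card_hi_fibre(2)[OF w(2)])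
    finally have "15 * q * b < (c + 3) * b" by (simp only: mult.commute)
    then have "15 * q < c + 3" by simp
    moreover have "1 \<le> q" using ak a_pos by (simp add: q_def Suc_le_eq div_greater_zero_iff)
    ultimately have "q + 1 < c" by linarith
    then show ?thesis using deg_hi[OF w(2)] by (simp add: w c_def q_def)
  qed
  have last: "hi (k - 1) = b - 1" by (rule hi_last[OF h_ge[OF ak]])
  have k1: "k - 1 < k" using k_ge by simp
  have "lo (p (k - 1)) = Q" using lo_tail(2)[OF ak k1 last] k_ge p_last by simp
  moreover have "a + hi (k - 1) = a + b - 1" using last b_ge by simp
  ultimately show "{Q, a + b - 1} \<in> C.E" using good_graph_chord[OF k1] by (simp add: good_graph_def)
  show "Q < a" using a_big(3) by simp
  have lt: "a - 1 < a + b" "a + b - 1 < a + b" "a - 1 - Q < a + b" "a < a + b" using b_ge by auto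
  show "{a - 1, a + b - 1} \<notin> C.E"
  proof -
    have "\<not> C.cyc (a - 1) (a + b - 1)" using b_ge ba by (auto simp: C.cyc_def)
    moreover have "False" if "t < k" "a - 1 = lo (p t)" "a + b - 1 = a + hi t" for t
      using p_avoid[OF that(1)] that ak b_ge by (auto simp: forbidden_def)
    moreover have "False" if "t < k" "a - 1 = a + hi t" for t using that a_pos by linarith
    ultimately show ?thesis using C.edge_iff[OF lt(1,2)] by metis
  qed
  show "{a - 1 - Q, a} \<notin> C.E"
  proof -
    have "\<not> C.cyc (a - 1 - Q) a" using b_ge ba Q_ge a_big(3) by (auto simp: C.cyc_def)
    moreover have "False" if "t < k" "a - 1 - Q = lo (p t)" "a = a + hi t" for t
      using p_avoid[OF that(1)] that ak by (auto simp: forbidden_def)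
    moreover have "False" if "t < k" "a - 1 - Q = a + hi t" for t using that a_pos by linarith
    ultimately show ?thesis using C.edge_iff[OF lt(3,4)] by metis
  qed
qed

text \<open>For \<open>k < a\<close> the low ends are distinct, with 0 among them and
  \<open>a - 1\<close> not, whereas every used vertex of the short arc has degree at least 4.
  Whether the last vertex is used decides between the path and the cycle argument.\<close>

lemma good_graph_rigid_thin:
  assumes ak: "k < a"
    and \<psi>: "bij_betw \<psi> {..<a + b} {..<a + b}"
      "\<And>u v. u < a + b \<Longrightarrow> v < a + b \<Longrightarrow> {\<psi> u, \<psi> v} \<in> C.E \<longleftrightarrow> {u, v} \<in> C.E"
  shows "\<forall>v<a + b. \<psi> v = v"
proof -
  have lo: "lo t = t * a div k" if "t < k" for t using that ak by (simp add: lo_def)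
  have low: "C.deg v \<le> 3" if "v < a" for v using card_lo_fibre[OF that] deg_lo[OF that] ak by simp
  have last_low: "C.deg (a - 1) = 2"
  proof -
    have "{t \<in> {..<k}. lo t = a - 1} = {}" using lo_partial_neq_last ak by auto
    then have "card {t \<in> {..<k}. lo t = a - 1} = 0" by (simp only: card.empty)
    moreover have "a - 1 < a" using a_pos by simp
    ultimately show ?thesis using deg_lo[of "a - 1"] by linarith
  qed
  have first_low: "C.deg 0 = 3"
  proof -
    have "0 \<in> {t \<in> {..<k}. lo t = 0}" using lo[of 0] k_ge by simp
    then have "card {t \<in> {..<k}. lo t = 0} \<noteq> 0" by auto
    then show ?thesis using deg_lo[OF a_pos] low[OF a_pos] by linarith
  qed
  have hub: "3 < C.deg (a + hi t)" if "t < k" for t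
    using card_hi_fibre_ge_2[OF that] deg_hi[OF hi_less[OF that]] by linarith
  have high2: "C.deg v = 2 \<or> 3 < C.deg v" if "a \<le> v" "v < a + b" for v
  proof -
    obtain w where w': "v = a + w" using \<open>a \<le> v\<close> le_Suc_ex by blast
    then have w: "v = a + w" "w < b" using \<open>v < a + b\<close> by auto
    show ?thesis
    proof (cases "\<exists>t<k. hi t = w")
      case True
      then show ?thesis using hub w by blast
    next
      case False
      then have "{t \<in> {..<k}. hi t = w} = {}" by auto
      then have "card {t \<in> {..<k}. hi t = w} = 0" by (simp only: card.empty)
      then show ?thesis using deg_hi[OF w(2)] unfolding w(1) by linarith
    qed
  qed
  then have high: "C.deg v \<noteq> 3" if "a \<le> v" "v < a + b" for v using that by fastforce
  have k1: "k - 1 < k" using k_ge by simp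
  show ?thesis
  proof (cases "b \<le> h")
    case True
    have "a + hi (k - 1) = a + b - 1" using hi_last[OF True] b_ge by simp
    then have "C.deg (a + b - 1) \<noteq> 2" using hub[OF k1] by simp
    with C.rigid_path[OF \<psi> low last_low first_low high] show ?thesis by simp
  next
    case False
    then have hb: "h < b" by simp
    \<comment> \<open>\<open>a + b - d\<close> is the last vertex of the short arc that carries a
      chord. The low ends are at least \<open>d + 1\<close> apart, and the last one is that far from
      the end of the long arc.\<close>
    define d where "d = b - hi (k - 1)"
    have gap: "k * (d + 1) \<le> a" unfolding d_def by (rule last_hi_gap[OF hb])
    show ?thesis
    proof (rule C.rigid_cycle[OF \<psi> low last_low first_low high, where d = d])
      have "{t \<in> {..<k}. hi t = b - 1} = {}" using hi_not_last[OF hb] by auto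
      then have "card {t \<in> {..<k}. hi t = b - 1} = 0" by (simp only: card.empty)
      moreover have "b - 1 < b" using b_pos by simp
      ultimately have "C.deg (a + (b - 1)) = 2" using deg_hi[of "b - 1"] by linarith
      then show "C.deg (a + b - 1) = 2" using b_ge by simp
      show "0 < d" "d \<le> a + b - a" using hi_less[OF k1] by (auto simp: d_def)
      have "a + b - d = a + hi (k - 1)" using hi_less[OF k1] by (simp add: d_def)
      then show "C.deg (a + b - d) \<noteq> 2" using hub[OF k1] by simp
      fix v assume v: "v < a" "C.deg v = 3"
      then have "card {t \<in> {..<k}. lo t = v} \<noteq> 0" using deg_lo by simp
      then have "{t \<in> {..<k}. lo t = v} \<noteq> {}" by (metis card.empty)
      then obtain t where t: "t < k" "v = t * a div k" using lo by auto
      show "v = 0 \<or> d \<le> v"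
      proof (cases "t = 0")
        case False
        then have "1 * a \<le> t * a" by (intro mult_le_mono1) simp
        then have "k * (d + 1) \<le> t * a" using gap by linarith
        then have "(d + 1) * k \<le> t * a" by (simp only: mult.commute)
        then have "d + 1 \<le> v" unfolding t(2) using k_ge by (simp add: less_eq_div_iff_mult_less_eq)
        then show ?thesis by simp
      qed (simp add: t)
      have "v * k \<le> t * a" unfolding t(2) by (rule div_times_less_eq_dividend)
      also have "\<dots> \<le> (k - 1) * a" using t(1) by (intro mult_le_mono1) simp
      also have "\<dots> = k * a - a" by (simp only: diff_mult_distrib mult_1)
      finally have "v * k \<le> k * a - a" .
      moreover have "a \<le> k * a" using k_ge by simp
      moreover have "d * k + k \<le> a" using gap by (simp add: algebra_simps)
      ultimately have "v * k + d * k < k * a" using k_ge by linarith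
      then have "k * (v + d) < k * a" by (simp add: algebra_simps)
      then show "v + d < a" by simp
    qed
  qed
qed

lemma good_graph_rigid:
  assumes "bij_betw \<psi> {..<a + b} {..<a + b}"
    "\<And>u v. u < a + b \<Longrightarrow> v < a + b \<Longrightarrow> {\<psi> u, \<psi> v} \<in> edges (good_graph p) \<longleftrightarrow> {u, v} \<in> edges (good_graph p)"
  shows "\<forall>v<a + b. \<psi> v = v"
proof (cases "a \<le> k")
  case True
  then show ?thesis
    by (rule good_graph_rigid_dense[OF _ assms(1)]) (use assms(2) in \<open>simp add: good_graph_def\<close>)
next
  case False
  then have "k < a" by simp
  then show ?thesis
    by (rule good_graph_rigid_thin[OF _ assms(1)]) (use assms(2) in \<open>simp add: good_graph_def\<close>)
qed

lemma relabelled_good_graph: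
  assumes lab: "inj_on lab {..<a + b}"
  shows "simple_graph (relabel lab (good_graph p))" "verts (relabel lab (good_graph p)) = lab ` {..<a + b}"
    "card (edges (relabel lab (good_graph p))) = a + b + k"
    "strictly_balanced (relabel lab (good_graph p))" "asymmetric (relabel lab (good_graph p))"
proof -
  have V: "verts (good_graph p) = {..<a + b}" by (simp add: good_graph_def)
  have lab': "inj_on lab (verts (good_graph p))" using lab by (simp add: V)
  note G = good_graph_simple
  show "simple_graph (relabel lab (good_graph p))" by (rule simple_graph_relabel[OF G lab'])
  show "verts (relabel lab (good_graph p)) = lab ` {..<a + b}" by (simp add: relabel_def V)
  show "card (edges (relabel lab (good_graph p))) = a + b + k"
    by (simp only: card_edges_relabel[OF G lab'] card_good_graph)
  show "strictly_balanced (relabel lab (good_graph p))"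
  proof (rule strictly_balanced_relabelI[OF G lab'])
    fix S assume "S \<subseteq> verts (good_graph p)" "S \<noteq> {}" "S \<noteq> verts (good_graph p)"
    then show "card (verts (good_graph p)) * card {e \<in> edges (good_graph p). e \<subseteq> S}
        < card (edges (good_graph p)) * card S"
      unfolding V card_good_graph card_lessThan by (rule good_graph_sparse)
  qed
  show "asymmetric (relabel lab (good_graph p))"
  proof (rule asymmetric_relabelI[OF G lab'])
    fix \<psi> assume \<psi>: "bij_betw \<psi> (verts (good_graph p)) (verts (good_graph p))"
      "\<And>u v. u \<in> verts (good_graph p) \<Longrightarrow> v \<in> verts (good_graph p) \<Longrightarrow>
        {\<psi> u, \<psi> v} \<in> edges (good_graph p) \<longleftrightarrow> {u, v} \<in> edges (good_graph p)"
    have "\<forall>v<a + b. \<psi> v = v" by (rule good_graph_rigid[OF \<psi>[unfolded V lessThan_iff]])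
    then show "\<forall>v\<in>verts (good_graph p). \<psi> v = v" unfolding V by blast
  qed
qed

end
end

section \<open>Counting labelled graphs\<close>

text \<open>An element is decoded coordinate by coordinate: each realised prefix of length
  \<open>i\<close> has at most \<open>d i\<close> extensions, so induction on the length bounds the
  number of prefixes.\<close>

lemma card_le_prod_branching:
  fixes coord :: "'x \<Rightarrow> nat \<Rightarrow> 'v" and d :: "nat \<Rightarrow> nat"
  assumes fin: "finite X"
    and inj: "\<And>x y. x \<in> X \<Longrightarrow> y \<in> X \<Longrightarrow> (\<forall>i<L. coord x i = coord y i) \<Longrightarrow> x = y"
    and branch: "\<And>i x. i < L \<Longrightarrow> x \<in> X \<Longrightarrow>
      card ((\<lambda>y. coord y i) ` {y \<in> X. \<forall>j<i. coord y j = coord x j}) \<le> d i"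
  shows "card X \<le> (\<Prod>i<L. d i)"
proof -
  define pre where "pre i x = map (coord x) [0..<i]" for i x
  have "card (pre i ` X) \<le> (\<Prod>j<i. d j)" if "i \<le> L" for i
    using that
  proof (induction i)
    case 0
    have "pre 0 ` X \<subseteq> {[]}" by (auto simp: pre_def)
    then show ?case using card_mono[of "{[]}" "pre 0 ` X"] by simp
  next
    case (Suc i)
    have "card (pre (Suc i) ` X) \<le> card (pre i ` X) * d i"
    proof (rule card_le_card_mult_fibres[where f = butlast])
      show "butlast ` (pre (Suc i) ` X) \<subseteq> pre i ` X" by (auto simp: pre_def)
      fix y assume "y \<in> pre i ` X"
      then obtain x where x: "x \<in> X" "y = pre i x" by blast
      let ?F = "{y \<in> X. \<forall>j<i. coord y j = coord x j}"
      have "{z \<in> pre (Suc i) ` X. butlast z = y} \<subseteq> (\<lambda>c. y @ [c]) ` ((\<lambda>y. coord y i) ` ?F)"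
      proof
        fix z assume "z \<in> {z \<in> pre (Suc i) ` X. butlast z = y}"
        then obtain w where w: "w \<in> X" "z = pre (Suc i) w" "pre i w = pre i x"
          using x by (auto simp: pre_def)
        then have "w \<in> ?F" "z = y @ [coord w i]" using x by (auto simp: pre_def)
        then show "z \<in> (\<lambda>c. y @ [c]) ` ((\<lambda>y. coord y i) ` ?F)" by blast
      qed
      then have "card {z \<in> pre (Suc i) ` X. butlast z = y} \<le> card ((\<lambda>y. coord y i) ` ?F)"
        using fin by (intro surj_card_le) auto
      also have "\<dots> \<le> d i" using branch[OF _ x(1)] Suc.prems by simp
      finally show "card {z \<in> pre (Suc i) ` X. butlast z = y} \<le> d i" .
    qed (use fin in auto)
    also have "\<dots> \<le> (\<Prod>j<i. d j) * d i" using Suc by (intro mult_le_mono1) simp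
    finally show ?case by simp
  qed
  moreover have "inj_on (pre L) X" by (rule inj_onI, rule inj) (auto simp: pre_def)
  ultimately show ?thesis by (metis card_image order_refl)
qed

context chord_ends
begin

text \<open>\<open>\<sigma>\<close> permutes the positions starting at 0; \<open>Suc\<close> moves
  the labels to the vertex set starting at 1.\<close>

definition labelled :: "(nat \<Rightarrow> nat) \<times> (nat \<Rightarrow> nat) \<Rightarrow> nat graph" where
  "labelled = (\<lambda>(\<sigma>, p). relabel (\<lambda>i. Suc (\<sigma> i)) (good_graph p))"

definition layouts :: "((nat \<Rightarrow> nat) \<times> (nat \<Rightarrow> nat)) set" where
  "layouts = {\<sigma>. \<sigma> permutes {..<a + b}} \<times> good"

lemma finite_good: "finite good"
  by (rule finite_subset[OF _ finite_permutations[of "{..<k}"]]) (auto simp: good_def)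

lemma finite_layouts: "finite layouts"
  unfolding layouts_def by (intro finite_cartesian_product finite_permutations finite_good) simp

lemma card_layouts: "card layouts = fact (a + b) * card good"
  by (simp add: layouts_def card_cartesian_product card_permutations)

lemma card_good_le: "card good \<le> fact k"
proof -
  have "card good \<le> card {p. p permutes {..<k}}"
    by (intro card_mono finite_permutations) (auto simp: good_def)
  then show ?thesis by (simp add: card_permutations)
qed

lemma inj_label: "\<sigma> permutes {..<a + b} \<Longrightarrow> inj_on (\<lambda>i. Suc (\<sigma> i)) {..<a + b}"
  using permutes_inj[of \<sigma> "{..<a + b}"] by (auto simp: inj_on_def inj_def)

lemma labelled_edge_iff:
  assumes "(\<sigma>, p) \<in> layouts" "u < a + b" "v < a + b"
  shows "{Suc (\<sigma> u), Suc (\<sigma> v)} \<in> edges (labelled (\<sigma>, p)) \<longleftrightarrow> {u, v} \<in> edges (good_graph p)"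
proof -
  have s: "\<sigma> permutes {..<a + b}" and p: "p \<in> good" using assms(1) by (auto simp: layouts_def)
  have "verts (good_graph p) = {..<a + b}" by (simp add: good_graph_def)
  then show ?thesis unfolding labelled_def case_prod_conv
    using edge_relabel_iff[OF good_graph_simple[OF p], of "\<lambda>i. Suc (\<sigma> i)" u v] inj_label[OF s] assms by simp
qed

lemma labelled_properties:
  assumes "x \<in> layouts"
  shows "simple_graph (labelled x)" "verts (labelled x) = {1..a + b}" "card (edges (labelled x)) = a + b + k"
    "strictly_balanced (labelled x)" "asymmetric (labelled x)"
proof -
  obtain \<sigma> p where x: "x = (\<sigma>, p)" "\<sigma> permutes {..<a + b}" "p \<in> good"
    using assms by (auto simp: layouts_def)
  have "(\<lambda>i. Suc (\<sigma> i)) ` {..<a + b} = Suc ` (\<sigma> ` {..<a + b})" by auto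
  also have "\<dots> = {1..a + b}" using permutes_image[OF x(2)] by (simp add: image_Suc_lessThan)
  finally have V: "(\<lambda>i. Suc (\<sigma> i)) ` {..<a + b} = {1..a + b}" .
  show "simple_graph (labelled x)" "verts (labelled x) = {1..a + b}" "card (edges (labelled x)) = a + b + k"
    "strictly_balanced (labelled x)" "asymmetric (labelled x)"
    using relabelled_good_graph[OF x(3) inj_label[OF x(2)]] V by (simp_all add: labelled_def x(1))
qed

lemma card_labelled_nbrs:
  assumes x: "(\<sigma>, p) \<in> layouts" and v: "v < a + b"
  shows "card {w. w < a + b \<and> {Suc w, Suc (\<sigma> v)} \<in> edges (labelled (\<sigma>, p))} \<le> Q + 2"
proof -
  have s: "\<sigma> permutes {..<a + b}" and p: "p \<in> good" using x by (auto simp: layouts_def)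
  have "{w. w < a + b \<and> {Suc w, Suc (\<sigma> v)} \<in> edges (labelled (\<sigma>, p))}
      \<subseteq> \<sigma> ` {u. u < a + b \<and> {u, v} \<in> edges (good_graph p)}"
  proof
    fix w assume w: "w \<in> {w. w < a + b \<and> {Suc w, Suc (\<sigma> v)} \<in> edges (labelled (\<sigma>, p))}"
    then obtain u where u: "u < a + b" "w = \<sigma> u" using permutes_image[OF s] by (metis (no_types, lifting) imageE lessThan_iff mem_Collect_eq)
    then have "{u, v} \<in> edges (good_graph p)" using w labelled_edge_iff[OF x u(1) v] by simp
    then show "w \<in> \<sigma> ` {u. u < a + b \<and> {u, v} \<in> edges (good_graph p)}" using u by blast
  qed
  then have "card {w. w < a + b \<and> {Suc w, Suc (\<sigma> v)} \<in> edges (labelled (\<sigma>, p))}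
      \<le> card {u. u < a + b \<and> {u, v} \<in> edges (good_graph p)}" by (intro surj_card_le) auto
  also have "\<dots> \<le> Q + 2" by (rule deg_good_graph[OF p v])
  finally show ?thesis .
qed

text \<open>Walking along the cycle, each label is a neighbour of the previous one; once all labels are
  known, each value of the pairing is a stub of a neighbour of a known vertex.\<close>

lemma card_labelled_fibre:
  "card {x \<in> layouts. labelled x = G} \<le> (a + b) * ((Q + 2) * Q) ^ (a + b + k)"
proof -
  let ?n = "a + b" and ?X = "{x \<in> layouts. labelled x = G}" and ?D = "(Q + 2) * Q"
  \<comment> \<open>The labels along the cycle come first and the values of the pairing afterwards,
    so that \<open>\<sigma>\<close> is completely known when the pairing is decoded.\<close>
  define coord where "coord x i = (if i < ?n then fst x i else snd x (i - ?n))" for x :: "(nat \<Rightarrow> nat) \<times> (nat \<Rightarrow> nat)" and i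
  define d where "d i = (if i = 0 then ?n else ?D)" for i :: nat
  have nbrs: "card {w. w < ?n \<and> {Suc w, Suc (\<sigma> v)} \<in> edges G} \<le> Q + 2"
    if "(\<sigma>, p) \<in> ?X" "v < ?n" for \<sigma> p v using card_labelled_nbrs[of \<sigma> p v] that by auto
  have perm: "\<sigma> permutes {..<?n}" "p permutes {..<k}" "p \<in> good" "(\<sigma>, p) \<in> layouts" "labelled (\<sigma>, p) = G"
    if "(\<sigma>, p) \<in> ?X" for \<sigma> p using that by (auto simp: layouts_def good_def)
  have "card ?X \<le> (\<Prod>i<?n + k. d i)"
  proof (rule card_le_prod_branching[where coord = coord])
    show "finite ?X" using finite_layouts by simp
  next
    fix x y assume xy: "x \<in> ?X" "y \<in> ?X" "\<forall>i<?n + k. coord x i = coord y i"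
    obtain \<sigma> p \<sigma>' p' where e: "x = (\<sigma>, p)" "y = (\<sigma>', p')" by (metis surj_pair)
    have "\<sigma> i = \<sigma>' i" for i
    proof (cases "i < ?n")
      case True
      then show ?thesis using xy(3)[rule_format, of i] by (simp add: coord_def e)
    next
      case False
      then show ?thesis using permutes_not_in[OF perm(1), of \<sigma> p i] permutes_not_in[OF perm(1), of \<sigma>' p' i] xy e by simp
    qed
    moreover have "p i = p' i" for i
    proof (cases "i < k")
      case True
      then show ?thesis using xy(3)[rule_format, of "?n + i"] by (simp add: coord_def e)
    next
      case False
      then show ?thesis using permutes_not_in[OF perm(2), of \<sigma> p i] permutes_not_in[OF perm(2), of \<sigma>' p' i] xy e by simp
    qed
    ultimately show "x = y" by (auto simp: e)
  next
    fix i x assume i: "i < ?n + k" and x: "x \<in> ?X"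
    obtain \<sigma> p where e: "x = (\<sigma>, p)" by (metis surj_pair)
    note P = perm[OF x[unfolded e]]
    let ?F = "{y \<in> ?X. \<forall>j<i. coord y j = coord x j}"
    consider "i = 0" | j where "i = Suc j" "i < ?n" | t where "i = ?n + t" "t < k"
    proof (cases "i < ?n")
      case True
      then show ?thesis using that(1,2) by (cases i) auto
    next
      case False
      then have "i = ?n + (i - ?n)" "i - ?n < k" using i by auto
      then show ?thesis by (rule that(3))
    qed
    then show "card ((\<lambda>y. coord y i) ` ?F) \<le> d i"
    proof cases
      case 1
      have "(\<lambda>y. coord y i) ` ?F \<subseteq> {..<?n}"
      proof
        fix c assume "c \<in> (\<lambda>y. coord y i) ` ?F"
        then obtain \<sigma>' p' where y: "(\<sigma>', p') \<in> ?X" "c = coord (\<sigma>', p') i" by auto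
        then have "c = \<sigma>' 0" using 1 a_pos by (simp add: coord_def)
        then show "c \<in> {..<?n}" using permutes_in_image[OF perm(1)[OF y(1)], of 0] a_pos by simp
      qed
      then have "card ((\<lambda>y. coord y i) ` ?F) \<le> card {..<?n}" by (intro card_mono) auto
      then show ?thesis using 1 by (simp add: d_def)
    next
      case 2
      have "(\<lambda>y. coord y i) ` ?F \<subseteq> {w. w < ?n \<and> {Suc w, Suc (\<sigma> j)} \<in> edges G}"
      proof
        fix c assume "c \<in> (\<lambda>y. coord y i) ` ?F"
        then obtain \<sigma>' p' where y: "(\<sigma>', p') \<in> ?X" "c = coord (\<sigma>', p') i"
          "\<forall>j<i. coord (\<sigma>', p') j = coord x j" by auto
        note P' = perm[OF y(1)]
        have c: "c = \<sigma>' (Suc j)" "\<sigma>' j = \<sigma> j" using y(2) y(3)[rule_format, of j] 2 by (auto simp: coord_def e)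
        have "{j, Suc j} \<in> edges (good_graph p')" using good_graph_cycle_edge[OF P'(3), of j] 2 by simp
        then have "{Suc j, j} \<in> edges (good_graph p')" by (simp add: insert_commute)
        then have "{Suc c, Suc (\<sigma> j)} \<in> edges G" using labelled_edge_iff[OF P'(4), of "Suc j" j] 2 P'(5) c by simp
        moreover have "c < ?n" using permutes_in_image[OF P'(1), of "Suc j"] 2 c by simp
        ultimately show "c \<in> {w. w < ?n \<and> {Suc w, Suc (\<sigma> j)} \<in> edges G}" by simp
      qed
      then have "card ((\<lambda>y. coord y i) ` ?F) \<le> card {w. w < ?n \<and> {Suc w, Suc (\<sigma> j)} \<in> edges G}"
        by (intro card_mono) auto
      also have "\<dots> \<le> Q + 2" using nbrs[of \<sigma> p j] x e 2 by simp
      also have "\<dots> \<le> (Q + 2) * Q" using Q_ge by simp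
      finally show ?thesis using 2 by (simp add: d_def)
    next
      case 3
      \<comment> \<open>\<open>?N\<close> lists the labels adjacent to the high end of chord
        \<open>t\<close>, and \<open>?M\<close> the stubs \<open>s\<close> whose low end has such a
        label. There are at most \<open>Q + 2\<close> labels, each with at most \<open>Q\<close>
        stubs.\<close>
      let ?N = "{w. w < ?n \<and> {Suc w, Suc (\<sigma> (a + hi t))} \<in> edges G}"
      let ?M = "{s \<in> {..<k}. \<sigma> (lo s) \<in> ?N}"
      have ht: "a + hi t < ?n" using hi_less 3 by simp
      have lon: "lo s < ?n" for s using lo_less[of s] by simp
      have "(\<lambda>y. coord y i) ` ?F \<subseteq> ?M"
      proof
        fix c assume "c \<in> (\<lambda>y. coord y i) ` ?F"
        then obtain \<sigma>' p' where y: "(\<sigma>', p') \<in> ?X" "c = coord (\<sigma>', p') i"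
          "\<forall>j<i. coord (\<sigma>', p') j = coord x j" by auto
        note P' = perm[OF y(1)]
        have c: "c = p' t" using y(2) 3 by (simp add: coord_def)
        have s: "\<sigma>' j = \<sigma> j" if "j < ?n" for j using y(3)[rule_format, of j] that 3 by (simp add: coord_def e)
        have "{lo c, a + hi t} \<in> edges (good_graph p')" using good_graph_chord[OF P'(3) 3(2)] c by simp
        then have "{Suc (\<sigma>' (lo c)), Suc (\<sigma>' (a + hi t))} \<in> edges G"
          using labelled_edge_iff[OF P'(4) lon ht, of c] P'(5) by simp
        then have "{Suc (\<sigma> (lo c)), Suc (\<sigma> (a + hi t))} \<in> edges G" using s[OF lon] s[OF ht] by simp
        moreover have "c < k" using permutes_in_image[OF P'(2), of t] 3 c by simp
        moreover have "\<sigma> (lo c) < ?n" using permutes_in_image[OF P(1), of "lo c"] lon by simp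
        ultimately show "c \<in> ?M" by simp
      qed
      then have "card ((\<lambda>y. coord y i) ` ?F) \<le> card ?M" by (intro card_mono) auto
      also have "\<dots> \<le> card ?N * Q"
      proof (rule card_le_card_mult_fibres[where f = "\<lambda>s. \<sigma> (lo s)"])
        fix w
        have "{s \<in> ?M. \<sigma> (lo s) = w} \<subseteq> {s \<in> {..<k}. lo s = inv \<sigma> w}"
          using permutes_inverses[OF P(1)] by auto
        then have "card {s \<in> ?M. \<sigma> (lo s) = w} \<le> card {s \<in> {..<k}. lo s = inv \<sigma> w}" by (intro card_mono) auto
        also have "\<dots> \<le> Q" by (rule card_lo_fibre_le)
        finally show "card {s \<in> ?M. \<sigma> (lo s) = w} \<le> Q" .
      qed auto
      also have "\<dots> \<le> ?D" using nbrs[of \<sigma> p "a + hi t"] x e ht by (intro mult_le_mono1) simp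
      finally show ?thesis using 3 a_pos by (simp add: d_def)
    qed
  qed
  also have "\<dots> = ?n * ?D ^ (?n + k - 1)"
  proof -
    obtain l where l: "?n + k = Suc l" using a_pos by (metis add_gr_0 gr0_implies_Suc)
    have "(\<Prod>i<Suc l. d i) = d 0 * (\<Prod>i<l. d (Suc i))" by (rule prod.lessThan_Suc_shift)
    also have "\<dots> = ?n * ?D ^ l" by (simp add: d_def)
    finally show ?thesis by (simp only: l diff_Suc_1)
  qed
  also have "\<dots> \<le> ?n * ?D ^ (?n + k)" using Q_ge by (intro mult_le_mono2 power_increasing) auto
  finally show ?thesis .
qed

text \<open>Every graph of the family arises from a bounded number of layouts, so the lower bound on
  \<open>card good\<close> carries over to a lower bound on the number of graphs.\<close>

lemma card_family:
  "card (labelled ` layouts) \<le> fact (a + b) * fact k"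
  "fact (a + b) * fact k \<le> ((Q + 4) * (Q + 4) + 2) ^ k * (card (labelled ` layouts) *
     ((a + b) * ((Q + 2) * Q) ^ (a + b + k)))"
proof -
  have "card (labelled ` layouts) \<le> card layouts" by (rule card_image_le[OF finite_layouts])
  also have "\<dots> \<le> fact (a + b) * fact k" unfolding card_layouts using card_good_le by (rule mult_le_mono2)
  finally show "card (labelled ` layouts) \<le> fact (a + b) * fact k" .
  have "fact (a + b) * fact k \<le> fact (a + b) * (((Q + 4) * (Q + 4) + 2) ^ k * card good)"
    using card_good by (rule mult_le_mono2)
  also have "\<dots> = ((Q + 4) * (Q + 4) + 2) ^ k * card layouts" by (simp only: card_layouts mult_ac)
  also have "card layouts \<le> card (labelled ` layouts) * ((a + b) * ((Q + 2) * Q) ^ (a + b + k))"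
    by (rule card_le_card_mult_fibres[where f = labelled])
      (use finite_layouts card_labelled_fibre in auto)
  finally show "fact (a + b) * fact k \<le> ((Q + 4) * (Q + 4) + 2) ^ k * (card (labelled ` layouts) *
     ((a + b) * ((Q + 2) * Q) ^ (a + b + k)))" by simp
qed

end

section \<open>From factorials to the final estimate\<close>

lemma power_le_fact_mult_exp:
  fixes x :: real
  assumes "0 \<le> x"
  shows "x ^ k \<le> fact k * exp x"
proof -
  \<comment> \<open>\<open>x ^ k / fact k\<close> is a single term of the exponential series, all of
    whose terms are nonnegative.\<close>
  have "(\<Sum>i\<in>{k}. x ^ i /\<^sub>R fact i) \<le> (\<Sum>i. x ^ i /\<^sub>R fact i)"
    by (rule sum_le_suminf[OF summable_exp_generic]) (use assms in auto)
  then have "x ^ k / fact k \<le> exp x" by (simp add: exp_def field_simps)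
  then show ?thesis by (simp add: field_simps)
qed

lemma fact_le_power_self: "(fact k :: real) \<le> real k ^ k"
  using fact_le_power[of k, where 'a = real] by simp

theorem theorem5:
  fixes c :: real
  assumes "c > 1"
  shows "\<exists>C > 0. \<exists>N :: nat. \<forall>n m :: nat.
    even n \<and> n > 0 \<and> n + 2 \<le> m \<and> real m \<le> c * real n \<longrightarrow>
    (\<exists>\<H> :: nat graph set.
       (\<forall>G \<in> \<H>. simple_graph G \<and> verts G = {1..n} \<and> card (edges G) = m \<and>
          strictly_balanced G \<and> asymmetric G) \<and>
       real (card \<H>) \<le> exp (C * real n) * real n ^ m \<and>
       (n \<ge> N \<longrightarrow> exp (- C * real n) * real n ^ m \<le> real (card \<H>)))"
proof -
  \<comment> \<open>For large \<open>n\<close> one has \<open>n \<le> 17 * b\<close>, so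
    \<open>k \<le> c * n\<close> gives \<open>k \<le> 17 * c * b\<close>; the summand 3 provides the
    \<open>3 * b\<close> in \<open>kQ\<close>.\<close>
  define Q where "Q = nat \<lceil>17 * c\<rceil> + 3"
  \<comment> \<open>The first factor is the loss per chord in counting pairings, the second the loss
    per edge in counting the layouts of a graph.\<close>
  define M where "M = real (((Q + 4) * (Q + 4) + 2) * ((Q + 2) * Q))"
  \<comment> \<open>The lower bound costs \<open>3 + c * ln M\<close>, and the upper bound needs
    \<open>c * ln c\<close> for the factor \<open>c ^ k\<close>.\<close>
  define C where "C = 3 + c * ln M + c * ln c"
  \<comment> \<open>From 240 on, the remainder modulo 16 is at most \<open>n div 16\<close>, which
    gives \<open>n \<le> 17 * b\<close>. The second summand together with
    \<open>n \<le> 2 * a\<close> gives \<open>Qa\<close>.\<close>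
  define N where "N = 240 + 2 * ((3 * Q + 5) * (3 * Q + 5))"
  have M1: "1 \<le> M"
  proof -
    have "1 * 1 \<le> ((Q + 4) * (Q + 4) + 2) * ((Q + 2) * Q)" by (rule mult_le_mono) (auto simp: Q_def)
    then show ?thesis unfolding M_def by linarith
  qed
  have lnM: "0 \<le> ln M" and lnc: "0 \<le> ln c" using M1 assms by auto
  have C0: "C > 0" using lnM lnc assms by (simp add: C_def add_pos_nonneg)
  have main: "\<exists>\<H> :: nat graph set.
       (\<forall>G \<in> \<H>. simple_graph G \<and> verts G = {1..n} \<and> card (edges G) = m \<and>
          strictly_balanced G \<and> asymmetric G) \<and>
       real (card \<H>) \<le> exp (C * real n) * real n ^ m \<and>
       (n \<ge> N \<longrightarrow> exp (- C * real n) * real n ^ m \<le> real (card \<H>))"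
    if n: "n > 0" and nm: "n + 2 \<le> m" and mc: "real m \<le> c * real n" for n m :: nat
  proof (cases "n \<ge> N")
    case False
    \<comment> \<open>Below \<open>N\<close> only the upper bound is claimed, so the empty family
      serves.\<close>
    then show ?thesis by (intro exI[of _ "{}"]) auto
  next
    case True
    define b a k where "b = n div 16" and "a = n - n div 16" and "k = m - n"
    have ab: "a + b = n" and nk: "n + k = m" using nm by (auto simp: a_def b_def k_def)
    have n17: "n \<le> 17 * b" "15 * b \<le> a" "2 \<le> b" "n \<le> 2 * a"
      using True unfolding N_def a_def b_def by linarith+
    have kc: "real k \<le> c * real n" using mc nm by (simp add: k_def)
    have "real k \<le> c * real (17 * b)"
      using kc n17(1) assms by (meson le_less_trans less_eq_real_def mult_left_mono of_nat_le_iff order_trans zero_le_one)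
    also have "\<dots> = (17 * c) * real b" by simp
    also have "\<dots> \<le> real (nat \<lceil>17 * c\<rceil>) * real b" by (intro mult_right_mono) linarith+
    finally have "k \<le> nat \<lceil>17 * c\<rceil> * b" by (metis of_nat_le_iff of_nat_mult)
    then have kQ: "k + 3 * b \<le> b * Q" by (simp add: Q_def algebra_simps)
    interpret chord_ends a b k Q
    proof
      show "2 \<le> k" using nm by (simp add: k_def)
      show "(3 * Q + 5) * (3 * Q + 5) \<le> a" using True n17(4) unfolding N_def by linarith
    qed (use n17 kQ in auto)
    let ?H = "labelled ` layouts"
    have props: "\<forall>G \<in> ?H. simple_graph G \<and> verts G = {1..n} \<and> card (edges G) = m \<and>
        strictly_balanced G \<and> asymmetric G"
      using labelled_properties unfolding ab nk by auto
    have nn: "real n \<ge> 0" by simp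
    have pow_m: "real n ^ m = real n ^ n * real n ^ k" using nm by (simp add: k_def flip: power_add)
    have exp_pow: "x ^ j = exp (ln x * real j)" if "x > 0" for x :: real and j
      using that by (metis exp_ln exp_of_nat2_mult)
    have upper: "real (card ?H) \<le> exp (C * real n) * real n ^ m"
    proof -
      have "real (card ?H) \<le> real (fact n * fact k)" using card_family(1) by (simp only: ab of_nat_le_iff)
      also have "\<dots> = fact n * fact k" by simp
      also have "\<dots> \<le> real n ^ n * real k ^ k" by (intro mult_mono fact_le_power_self) auto
      also have "\<dots> \<le> real n ^ n * (c * real n) ^ k" using kc by (intro mult_left_mono power_mono) auto
      also have "\<dots> = c ^ k * real n ^ m" by (simp add: pow_m power_mult_distrib)
      also have "c ^ k \<le> exp (C * real n)"
      proof -
        have "ln c * real k \<le> ln c * (c * real n)" using kc lnc by (rule mult_left_mono)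
        also have "\<dots> \<le> C * real n" using lnM assms by (simp add: C_def algebra_simps)
        finally show ?thesis using exp_pow[of c k] assms by simp
      qed
      finally show ?thesis by (simp add: mult_right_mono)
    qed
    have lower: "exp (- C * real n) * real n ^ m \<le> real (card ?H)"
    proof -
      let ?c = "real (card ?H)"
      define K D where "K = real ((Q + 4) * (Q + 4) + 2)" and "D = real ((Q + 2) * Q)"
      have KD3: "K * D = M" unfolding K_def D_def M_def by (rule of_nat_mult[symmetric])
      have "1 \<le> (Q + 4) * (Q + 4) + 2" "1 * 1 \<le> (Q + 2) * Q" by (auto simp: Q_def intro: mult_le_mono)
      then have KD: "1 \<le> K" "1 \<le> D" unfolding K_def D_def by linarith+
      have "real (fact n * fact k) \<le> real (((Q + 4) * (Q + 4) + 2) ^ k * (card ?H * (n * ((Q + 2) * Q) ^ m)))"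
        using card_family(2) unfolding ab nk by (simp only: of_nat_le_iff)
      then have f: "fact n * fact k \<le> K ^ k * (?c * (real n * D ^ m))"
        by (simp only: of_nat_mult of_nat_power of_nat_fact K_def D_def)
      \<comment> \<open>Both powers of \<open>n\<close> are compared with the exponential series at
        \<open>n\<close>, also the one with exponent \<open>k\<close>; this avoids comparing
        \<open>k\<close> with \<open>n\<close>.\<close>
      have "real n ^ m \<le> (fact n * exp (real n)) * (fact k * exp (real n))"
        unfolding pow_m by (intro mult_mono power_le_fact_mult_exp) auto
      also have "\<dots> = (fact n * fact k) * exp (2 * real n)" by (simp add: mult_exp_exp algebra_simps flip: exp_add)
      also have "\<dots> \<le> K ^ k * (?c * (real n * D ^ m)) * exp (2 * real n)" using f by (intro mult_right_mono) auto
      also have "\<dots> = ?c * (exp (2 * real n) * real n * (K ^ k * D ^ m))" by (simp add: algebra_simps)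
      \<comment> \<open>The factor \<open>n\<close>, which comes from the free choice of the first
        label, is absorbed by a third exponential.\<close>
      also have "\<dots> \<le> ?c * (exp (2 * real n) * exp (real n) * (K ^ m * D ^ m))"
      proof (intro mult_left_mono mult_mono)
        show "real n \<le> exp (real n)" using exp_ge_add_one_self[of "real n"] by linarith
        show "K ^ k \<le> K ^ m" using KD by (intro power_increasing) (auto simp: k_def)
      qed (use KD in auto)
      also have "\<dots> = ?c * exp (3 * real n + ln M * real m)"
        using exp_pow[of M m] M1 KD3 by (simp add: power_mult_distrib[symmetric] exp_add[symmetric] algebra_simps)
      also have "\<dots> \<le> ?c * exp (C * real n)"
      proof -
        have "ln M * real m \<le> ln M * (c * real n)" using mc lnM by (rule mult_left_mono)
        moreover have "0 \<le> c * ln c * real n" using lnc assms by simp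
        ultimately have "3 * real n + ln M * real m \<le> C * real n" by (simp add: C_def algebra_simps)
        then show ?thesis by (intro mult_left_mono) auto
      qed
      finally have "real n ^ m \<le> ?c * exp (C * real n)" .
      then show ?thesis by (simp add: exp_minus field_simps)
    qed
    show ?thesis using props upper lower by blast
  qed
  show ?thesis using C0 main by blast
qed

end
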